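(* Let $p$ be an odd prime and let $G$ be a $p$-group of order $p^m$ of rank $5$ with $G\in\Phi_4$. Then (1) $\displaystyle A_G(t/|G|)=\frac{1-p^{-1}}{1-p^{-2}t} + \frac{p^{-1}-p^{-3}}{1-p^{-1}t} + \frac{p^{-3}}{1-t}$; (2) $\displaystyle B_G(t/|G|)=\frac{-p^{-1}}{1-p^{-3}t} + \frac{1}{1-p^{-2}t} + \frac{p^{-1}}{1-p^{-1}t}$.
   Context: For a finite group $G$ and $n\ge 0$, $\alpha_{G,n}$ denotes the number of orbits of $G$ acting on $G^n$ by simultaneous conjugation $g\cdot(x_1,\dots,x_n)=(gx_1g^{-1},\dots,gx_ng^{-1})$, and $\beta_{G,n}$ denotes the number of orbits of the same action on the set $G^{(n)}$ of $n$-tuples of pairwise commuting elements of $G$; $\alpha_{G,0}=\beta_{G,0}=1$. Set $A_G(t)=\sum_{n\ge 0}\alpha_{G,n}t^n$ and $B_G(t)=\sum_{n\ge 0}\beta_{G,n}t^n$ (formal power series, which are rational functions of $t$). $A_G(t/|G|)$, $B_G(t/|G|)$ denote the result of substituting $t/|G|$ for $t$. Finite groups $G,H$ are isoclinic if there are isomorphisms $\theta:G/Z(G)\to H/Z(H)$ and $\phi:G'\to H'$ (derived subgroups) such that $\phi([g_1,g_2])=[h_1,h_2]$ whenever $\theta(g_iZ(G))=h_iZ(H)$ for $i=1,2$. Isoclinism is an equivalence relation, whose classes are called isoclinism families. For a $p$-group $G$, the rank of (the family of) $G$ is the smallest $r$ such that the isoclinism family of $G$ contains a group of order $p^r$. $\Phi_4$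 (James's notation) is the isoclinism family, of rank 5, of the group of order $p^5$ $$\Phi_4(1^5)=\langle \alpha, \alpha_1, \alpha_2,\beta_1,\beta_2\mid[\alpha_i,\alpha]=\beta_i,\ \alpha^p=\alpha_i^p=\beta_i^p=1\ (i=1,2) \rangle .$$ Here $[x,y]=x^{-1}y^{-1}xy$, and by convention all pairs of generators whose commutator is not listed commute. $G\in\Phi_4$ means $G$ is a finite $p$-group isoclinic to this group. *)

theory Defs
  imports "HOL-Computational_Algebra.Formal_Power_Series" "HOL-Algebra.Algebra"
begin

section \<open>Simultaneous conjugation and its orbit counts\<close>

text \<open>An \<open>n\<close>-tuple over \<open>G\<close> is a list of length \<open>n\<close>.\<close>

definition tuples :: "('a, 'b) monoid_scheme \<Rightarrow> nat \<Rightarrow> 'a list set" where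
  "tuples G n = {xs. length xs = n \<and> set xs \<subseteq> carrier G}"

definition commuting_tuples :: "('a, 'b) monoid_scheme \<Rightarrow> nat \<Rightarrow> 'a list set" where
  "commuting_tuples G n =
     {xs \<in> tuples G n. \<forall>x \<in> set xs. \<forall>y \<in> set xs. x \<otimes>\<^bsub>G\<^esub> y = y \<otimes>\<^bsub>G\<^esub> x}"

text \<open>The restriction to \<open>E\<close> is what makes this a \<open>group_action\<close> in the sense of HOL-Algebra,
  whose actions are by extensional functions.\<close>

definition sim_conj :: "('a, 'b) monoid_scheme \<Rightarrow> 'a list set \<Rightarrow> 'a \<Rightarrow> 'a list \<Rightarrow> 'a list" where
  "sim_conj G E g = (\<lambda>xs \<in> E. map (\<lambda>x. g \<otimes>\<^bsub>G\<^esub> x \<otimes>\<^bsub>G\<^esub> inv\<^bsub>G\<^esub> g) xs)"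

definition alpha_count :: "('a, 'b) monoid_scheme \<Rightarrow> nat \<Rightarrow> nat" where
  "alpha_count G n = card (orbits G (tuples G n) (sim_conj G (tuples G n)))"

definition beta_count :: "('a, 'b) monoid_scheme \<Rightarrow> nat \<Rightarrow> nat" where
  "beta_count G n = card (orbits G (commuting_tuples G n) (sim_conj G (commuting_tuples G n)))"

definition A_series :: "('a, 'b) monoid_scheme \<Rightarrow> rat fps" where
  "A_series G = Abs_fps (\<lambda>n. of_nat (alpha_count G n))"

definition B_series :: "('a, 'b) monoid_scheme \<Rightarrow> rat fps" where
  "B_series G = Abs_fps (\<lambda>n. of_nat (beta_count G n))"


section \<open>Isoclinism\<close>

definition group_center :: "('a, 'b) monoid_scheme \<Rightarrow> 'a set" where
  "group_center G = {z \<in> carrier G. \<forall>x \<in> carrier G. z \<otimes>\<^bsub>G\<^esub> x = x \<otimes>\<^bsub>G\<^esub> z}"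

text \<open>The convention is \<open>[x, y] = x\<^sup>-\<^sup>1 y\<^sup>-\<^sup>1 x y\<close>, whereas the library's \<open>derived\<close> is generated by the
  elements \<open>x y x\<^sup>-\<^sup>1 y\<^sup>-\<^sup>1\<close>; both give the same derived subgroup.\<close>

definition commutator :: "('a, 'b) monoid_scheme \<Rightarrow> 'a \<Rightarrow> 'a \<Rightarrow> 'a" where
  "commutator G x y = inv\<^bsub>G\<^esub> x \<otimes>\<^bsub>G\<^esub> inv\<^bsub>G\<^esub> y \<otimes>\<^bsub>G\<^esub> x \<otimes>\<^bsub>G\<^esub> y"

definition derived_group :: "('a, 'b) monoid_scheme \<Rightarrow> ('a, 'b) monoid_scheme" where
  "derived_group G = G\<lparr>carrier := derived G (carrier G)\<rparr>"

definition isoclinic :: "('a, 'b) monoid_scheme \<Rightarrow> ('c, 'd) monoid_scheme \<Rightarrow> bool" where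
  "isoclinic G H \<longleftrightarrow>
     (\<exists>\<theta> \<phi>. \<theta> \<in> iso (G Mod group_center G) (H Mod group_center H) \<and>
            \<phi> \<in> iso (derived_group G) (derived_group H) \<and>
            (\<forall>g\<^sub>1 \<in> carrier G. \<forall>g\<^sub>2 \<in> carrier G. \<forall>h\<^sub>1 \<in> carrier H. \<forall>h\<^sub>2 \<in> carrier H.
               \<theta> (g\<^sub>1 <#\<^bsub>G\<^esub> group_center G) = h\<^sub>1 <#\<^bsub>H\<^esub> group_center H \<and>
               \<theta> (g\<^sub>2 <#\<^bsub>G\<^esub> group_center G) = h\<^sub>2 <#\<^bsub>H\<^esub> group_center H \<longrightarrow>
               \<phi> (commutator G g\<^sub>1 g\<^sub>2) = commutator H h\<^sub>1 h\<^sub>2))"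

text \<open>Groups with carrier in \<open>nat\<close> suffice: for \<open>p > 0\<close> a group of order \<open>p ^ r\<close> is finite, hence
  isomorphic to one of these, and isoclinism is invariant under isomorphism.\<close>

definition isoclinism_rank :: "nat \<Rightarrow> ('a, 'b) monoid_scheme \<Rightarrow> nat" where
  "isoclinism_rank p G =
     (LEAST r. \<exists>H :: nat monoid. group H \<and> Coset.order H = p ^ r \<and> isoclinic G H)"


section \<open>Groups given by generators and relations\<close>

text \<open>The letter \<open>(x, True)\<close> stands for the generator \<open>x\<close> and \<open>(x, False)\<close> for its inverse. A
  relation \<open>r = s\<close> is a pair \<open>(r, s)\<close> of words.\<close>

type_synonym 'x word = "('x \<times> bool) list"

inductive word_eq :: "('x word \<times> 'x word) set \<Rightarrow> 'x word \<Rightarrow> 'x word \<Rightarrow> bool"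
  for R :: "('x word \<times> 'x word) set" where
  refl: "word_eq R u u"
| sym: "word_eq R u v \<Longrightarrow> word_eq R v u"
| trans: "word_eq R u v \<Longrightarrow> word_eq R v w \<Longrightarrow> word_eq R u w"
| cancel: "word_eq R (u @ [(x, b), (x, \<not> b)] @ v) (u @ v)"
| relation: "(r, s) \<in> R \<Longrightarrow> word_eq R (u @ r @ v) (u @ s @ v)"

definition presented_group :: "('x word \<times> 'x word) set \<Rightarrow> 'x word set monoid" where
  "presented_group R =
     \<lparr>carrier = UNIV // {(u, v). word_eq R u v},
      mult = (\<lambda>K L. {w. \<exists>u \<in> K. \<exists>v \<in> L. word_eq R (u @ v) w}),
      one = {w. word_eq R [] w}\<rparr>"

definition gen :: "'x \<Rightarrow> 'x word" where
  "gen x = [(x, True)]"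

definition comm_word :: "'x \<Rightarrow> 'x \<Rightarrow> 'x word" where
  "comm_word x y = [(x, False), (y, False), (x, True), (y, True)]"

definition pow_word :: "'x \<Rightarrow> nat \<Rightarrow> 'x word" where
  "pow_word x n = replicate n (x, True)"

lemma word_eq_append_left: "word_eq R u v \<Longrightarrow> word_eq R (a @ u) (a @ v)"
proof (induction rule: word_eq.induct)
  case (cancel u x b v)
  show ?case using word_eq.cancel[of R "a @ u" x b v] by simp
next
  case (relation r s u v)
  then show ?case using word_eq.relation[of r s R "a @ u" v] by simp
qed (blast intro: word_eq.intros)+

lemma word_eq_append_right: "word_eq R u v \<Longrightarrow> word_eq R (u @ a) (v @ a)"
proof (induction rule: word_eq.induct)
  case (cancel u x b v)
  show ?case using word_eq.cancel[of R u x b "v @ a"] by simp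
next
  case (relation r s u v)
  then show ?case using word_eq.relation[of r s R u "v @ a"] by simp
qed (blast intro: word_eq.intros)+

lemma word_eq_append:
  "word_eq R u u' \<Longrightarrow> word_eq R v v' \<Longrightarrow> word_eq R (u @ v) (u' @ v')"
  by (meson word_eq.trans word_eq_append_left word_eq_append_right)

lemma presented_group_carrier: "carrier (presented_group R) = range (\<lambda>u. {w. word_eq R u w})"
  by (auto simp: presented_group_def quotient_def)

lemma presented_group_mult:
  "{w. word_eq R u w} \<otimes>\<^bsub>presented_group R\<^esub> {w. word_eq R v w} = {w. word_eq R (u @ v) w}"
  unfolding presented_group_def
  by (auto intro: word_eq.refl word_eq.sym word_eq.trans dest: word_eq_append)

lemma presented_group_one: "\<one>\<^bsub>presented_group R\<^esub> = {w. word_eq R [] w}"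
  by (simp add: presented_group_def)

lemma word_eq_left_inverse: "\<exists>v. word_eq R (v @ u) []"
proof (induction u)
  case Nil
  show ?case using word_eq.refl[of R "[]"] by (intro exI[of _ "[]"]) simp
next
  case (Cons l u)
  obtain x b where l: "l = (x, b)" by (cases l)
  from Cons obtain v where v: "word_eq R (v @ u) []" ..
  have "word_eq R ((v @ [(x, \<not> b)]) @ l # u) (v @ u)"
    using word_eq.cancel[of R v x "\<not> b" u] by (simp add: l)
  then show ?case using v word_eq.trans by blast
qed

lemma group_presented_group: "group (presented_group R)"
proof (rule groupI)
  fix K assume "K \<in> carrier (presented_group R)"
  then obtain u where K: "K = {w. word_eq R u w}"
    by (auto simp: presented_group_carrier)
  obtain v where "word_eq R (v @ u) []" using word_eq_left_inverse by blast
  then have "{w. word_eq R (v @ u) w} = {w. word_eq R [] w}"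
    by (auto intro: word_eq.sym word_eq.trans)
  then show "\<exists>L \<in> carrier (presented_group R).
      L \<otimes>\<^bsub>presented_group R\<^esub> K = \<one>\<^bsub>presented_group R\<^esub>"
    by (auto simp: presented_group_carrier presented_group_mult presented_group_one K)
qed (auto simp: presented_group_carrier presented_group_mult presented_group_one)


section \<open>The family $\Phi_4$\<close>

datatype phi4_gen = Alpha | Alpha1 | Alpha2 | Beta1 | Beta2

definition phi4_rels :: "nat \<Rightarrow> (phi4_gen word \<times> phi4_gen word) set" where
  "phi4_rels p =
     {(comm_word Alpha1 Alpha, gen Beta1), (comm_word Alpha2 Alpha, gen Beta2)} \<union>
     {(pow_word x p, []) | x. True} \<union>
     {(comm_word x y, []) | x y. {x, y} \<noteq> {Alpha1, Alpha} \<and> {x, y} \<noteq> {Alpha2, Alpha}}"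

definition phi4_1_5 :: "nat \<Rightarrow> phi4_gen word set monoid" where
  "phi4_1_5 p = presented_group (phi4_rels p)"

definition in_Phi4 :: "nat \<Rightarrow> ('a, 'b) monoid_scheme \<Rightarrow> bool" where
  "in_Phi4 p G \<longleftrightarrow> group G \<and> (\<exists>k. Coset.order G = p ^ k) \<and> isoclinic G (phi4_1_5 p)"

end

theory Submission
  imports Defs "HOL-Number_Theory.Cong"
begin

text \<open>
  By the orbit counting lemma the number of orbits on \<open>G\<^sup>n\<close> is the average over \<open>g\<close> of
  \<open>\<bar>C(g)\<bar>\<^sup>n\<close>, and the number of orbits on commuting \<open>n\<close>-tuples is \<open>1 / \<bar>G\<bar>\<close> times the number of
  commuting \<open>(n + 1)\<close>-tuples, since a pair of \<open>g\<close> and a commuting tuple fixed by \<open>g\<close> is a longer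
  commuting tuple.

  In the group \<open>\<Phi>\<^sub>4(1\<^sup>5)\<close> every element is \<open>\<alpha>\<^sup>a \<alpha>\<^sub>1\<^sup>b \<alpha>\<^sub>2\<^sup>c \<beta>\<^sub>1\<^sup>d \<beta>\<^sub>2\<^sup>e\<close> with exponents unique
  modulo \<open>p\<close>; the centre is \<open>\<langle>\<beta>\<^sub>1, \<beta>\<^sub>2\<rangle>\<close>, and elements with exponents \<open>(a, b, c)\<close> and
  \<open>(a', b', c')\<close> commute iff \<open>b a' = b' a\<close> and \<open>c a' = c' a\<close> modulo \<open>p\<close>. An isoclinism carries
  this description of the commuting relation on the central quotient over to \<open>G\<close>. Hence the
  centralizer of a noncentral element is commutative and has index \<open>p\<close> or \<open>p\<^sup>2\<close> according to
  whether \<open>a = 0\<close>. Commutativity of these centralizers turns the count of commuting tuples into a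
  linear recursion.
\<close>

section \<open>Orbit counts in terms of centralizers\<close>

definition centralizer :: "('a, 'b) monoid_scheme \<Rightarrow> 'a \<Rightarrow> 'a set" where
  "centralizer G g = {x \<in> carrier G. g \<otimes>\<^bsub>G\<^esub> x = x \<otimes>\<^bsub>G\<^esub> g}"

context group
begin

lemma conj_mult:
  "\<lbrakk>g \<in> carrier G; h \<in> carrier G; x \<in> carrier G\<rbrakk> \<Longrightarrow>
     g \<otimes> (h \<otimes> x \<otimes> inv h) \<otimes> inv g = (g \<otimes> h) \<otimes> x \<otimes> inv (g \<otimes> h)"
  by (simp add: inv_mult_group m_assoc)

lemma conj_eq_iff:
  "\<lbrakk>g \<in> carrier G; x \<in> carrier G\<rbrakk> \<Longrightarrow> g \<otimes> x \<otimes> inv g = x \<longleftrightarrow> g \<otimes> x = x \<otimes> g"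
  by (metis inv_solve_right m_closed)

lemma conj_commute:
  assumes "g \<in> carrier G" "x \<in> carrier G" "y \<in> carrier G" "x \<otimes> y = y \<otimes> x"
  shows "(g \<otimes> x \<otimes> inv g) \<otimes> (g \<otimes> y \<otimes> inv g) = (g \<otimes> y \<otimes> inv g) \<otimes> (g \<otimes> x \<otimes> inv g)"
proof -
  have "(g \<otimes> a \<otimes> inv g) \<otimes> (g \<otimes> b \<otimes> inv g) = g \<otimes> (a \<otimes> b) \<otimes> inv g"
    if "a \<in> carrier G" "b \<in> carrier G" for a b
    using assms(1) that by (simp add: m_assoc) (simp add: m_assoc[symmetric])
  then show ?thesis using assms by simp
qed

text \<open>Stated for any set of lists over the group that is stable under conjugation, so that it
  serves both all tuples and commuting tuples. Conjugation by \<open>inv g\<close> undoes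
  conjugation by \<open>g\<close>.\<close>

lemma sim_conj_action:
  assumes E: "\<And>xs. xs \<in> E \<Longrightarrow> set xs \<subseteq> carrier G"
    and closed: "\<And>g xs. \<lbrakk>g \<in> carrier G; xs \<in> E\<rbrakk> \<Longrightarrow> map (\<lambda>x. g \<otimes> x \<otimes> inv g) xs \<in> E"
  shows "group_action G E (sim_conj G E)"
proof -
  have mult: "sim_conj G E g (sim_conj G E h xs) = sim_conj G E (g \<otimes> h) xs"
    if "g \<in> carrier G" "h \<in> carrier G" "xs \<in> E" for g h xs
    using that closed[of h xs] E[of xs] by (auto simp: sim_conj_def conj_mult subset_iff)
  have one: "sim_conj G E \<one> xs = xs" if "xs \<in> E" for xs
    using that E[of xs] by (auto simp: sim_conj_def subset_iff intro!: map_idI)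
  have in_E: "sim_conj G E g xs \<in> E" if "g \<in> carrier G" "xs \<in> E" for g xs
    using that closed by (simp add: sim_conj_def)
  have bij: "sim_conj G E g \<in> Bij E" if g: "g \<in> carrier G" for g
  proof -
    have "bij_betw (sim_conj G E g) E E"
      by (rule bij_betw_byWitness[where f' = "sim_conj G E (inv g)"])
        (use g in \<open>auto simp: mult one in_E\<close>)
    then show ?thesis by (simp add: Bij_def sim_conj_def)
  qed
  have hom: "sim_conj G E (g \<otimes> h) = compose E (sim_conj G E g) (sim_conj G E h)"
    if "g \<in> carrier G" "h \<in> carrier G" for g h
  proof
    fix xs
    show "sim_conj G E (g \<otimes> h) xs = compose E (sim_conj G E g) (sim_conj G E h) xs"
      using mult[OF that, of xs] by (cases "xs \<in> E") (auto simp: compose_def sim_conj_def)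
  qed
  have "sim_conj G E \<in> hom G (BijGroup E)"
    by (rule homI) (auto simp: BijGroup_def bij hom)
  then show ?thesis
    by (simp add: group_action_def group_hom_def group_hom_axioms_def is_group group_BijGroup)
qed

text \<open>Burnside's lemma: a list is fixed by \<open>g\<close> exactly when each of its entries
  commutes with \<open>g\<close>.\<close>

lemma card_orbits_sim_conj:
  assumes fin: "finite (carrier G)" "finite E"
    and E: "\<And>xs. xs \<in> E \<Longrightarrow> set xs \<subseteq> carrier G"
    and closed: "\<And>g xs. \<lbrakk>g \<in> carrier G; xs \<in> E\<rbrakk> \<Longrightarrow> map (\<lambda>x. g \<otimes> x \<otimes> inv g) xs \<in> E"
  shows "card (orbits G E (sim_conj G E)) * order G =
         (\<Sum>g \<in> carrier G. card {xs \<in> E. set xs \<subseteq> centralizer G g})"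
proof -
  interpret group_action G E "sim_conj G E"
    using sim_conj_action[OF E closed] .
  have "invariants E (sim_conj G E) g = {xs \<in> E. set xs \<subseteq> centralizer G g}"
    if g: "g \<in> carrier G" for g
  proof -
    have "sim_conj G E g xs = xs \<longleftrightarrow> set xs \<subseteq> centralizer G g" if xs: "xs \<in> E" for xs
    proof -
      have "sim_conj G E g xs = xs \<longleftrightarrow> (\<forall>x \<in> set xs. g \<otimes> x \<otimes> inv g = x)"
        using xs by (simp add: sim_conj_def map_idI list_eq_iff_nth_eq all_set_conv_all_nth)
      then show ?thesis
        using E[OF xs] g by (auto simp: centralizer_def conj_eq_iff subset_iff)
    qed
    then show ?thesis by (auto simp: invariants_def)
  qed
  then show ?thesis using burnside[OF fin] by simp
qed

lemma finite_tuples: "finite (carrier G) \<Longrightarrow> finite (tuples G n)"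
  using finite_lists_length_eq[of "carrier G" n] by (simp add: tuples_def conj_ac)

lemma finite_commuting_tuples: "finite (carrier G) \<Longrightarrow> finite (commuting_tuples G n)"
  using finite_tuples[of n] by (simp add: commuting_tuples_def)

lemma alpha_count_order:
  assumes fin: "finite (carrier G)"
  shows "alpha_count G n * order G = (\<Sum>g \<in> carrier G. card (centralizer G g) ^ n)"
proof -
  have "card {xs \<in> tuples G n. set xs \<subseteq> centralizer G g} = card (centralizer G g) ^ n" for g
  proof -
    have sub: "centralizer G g \<subseteq> carrier G" by (auto simp: centralizer_def)
    have "{xs \<in> tuples G n. set xs \<subseteq> centralizer G g} =
          {xs. set xs \<subseteq> centralizer G g \<and> length xs = n}"
      using sub by (auto simp: tuples_def)
    then show ?thesis
      using card_lists_length_eq[OF finite_subset[OF sub fin]] by simp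
  qed
  then show ?thesis
    unfolding alpha_count_def
    by (subst card_orbits_sim_conj[OF fin finite_tuples[OF fin]]) (auto simp: tuples_def)
qed

text \<open>Split off the first entry \<open>g\<close>: the tail is a commuting tuple whose entries
  centralize \<open>g\<close>.\<close>

lemma card_commuting_tuples_Suc_sum:
  assumes fin: "finite (carrier G)"
  shows "card (commuting_tuples G (Suc n)) =
         (\<Sum>g \<in> carrier G. card {xs \<in> commuting_tuples G n. set xs \<subseteq> centralizer G g})"
proof -
  let ?S = "SIGMA g : carrier G. {xs \<in> commuting_tuples G n. set xs \<subseteq> centralizer G g}"
  have "commuting_tuples G (Suc n) = (\<lambda>(g, xs). g # xs) ` ?S" (is "?L = ?R")
  proof
    show "?R \<subseteq> ?L"
      by (auto simp: commuting_tuples_def tuples_def centralizer_def subset_iff)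
    show "?L \<subseteq> ?R"
    proof
      fix ys assume ys: "ys \<in> ?L"
      then obtain g xs where "ys = g # xs"
        by (cases ys) (auto simp: commuting_tuples_def tuples_def)
      then show "ys \<in> ?R"
        using ys by (auto simp: commuting_tuples_def tuples_def centralizer_def image_iff)
    qed
  qed
  moreover have "inj_on (\<lambda>(g, xs). g # xs) ?S" by (auto simp: inj_on_def)
  ultimately have "card (commuting_tuples G (Suc n)) = card ?S" by (simp add: card_image)
  then show ?thesis
    using fin finite_commuting_tuples[OF fin, of n] by simp
qed

text \<open>Burnside's sum for commuting \<open>n\<close>-tuples is the sum that counts commuting
  tuples of length \<open>Suc n\<close> by their first entry.\<close>

lemma beta_count_order:
  assumes fin: "finite (carrier G)"
  shows "beta_count G n * order G = card (commuting_tuples G (Suc n))"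
  unfolding beta_count_def card_commuting_tuples_Suc_sum[OF fin]
  by (subst card_orbits_sim_conj[OF fin finite_commuting_tuples[OF fin]])
    (auto simp: commuting_tuples_def tuples_def intro!: conj_commute)

text \<open>A central first entry puts no condition on the tail. After a noncentral first entry
  \<open>g\<close>, every tuple over \<open>centralizer G g\<close> is admissible, because that
  centralizer is commutative.\<close>

lemma card_commuting_tuples_Suc:
  assumes fin: "finite (carrier G)"
    and comm: "\<And>g x y. \<lbrakk>g \<in> carrier G - group_center G; x \<in> centralizer G g; y \<in> centralizer G g\<rbrakk>
                 \<Longrightarrow> x \<otimes> y = y \<otimes> x"
  shows "card (commuting_tuples G (Suc n)) =
         card (group_center G) * card (commuting_tuples G n) +
         (\<Sum>g \<in> carrier G - group_center G. card (centralizer G g) ^ n)"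
proof -
  let ?c = "\<lambda>g. card {xs \<in> commuting_tuples G n. set xs \<subseteq> centralizer G g}"
  have Z: "group_center G \<subseteq> carrier G" by (auto simp: group_center_def)
  have central: "?c g = card (commuting_tuples G n)" if "g \<in> group_center G" for g
  proof -
    have "{xs \<in> commuting_tuples G n. set xs \<subseteq> centralizer G g} = commuting_tuples G n"
      using that by (auto simp: commuting_tuples_def tuples_def centralizer_def group_center_def)
    then show ?thesis by simp
  qed
  have noncentral: "?c g = card (centralizer G g) ^ n" if g: "g \<in> carrier G - group_center G" for g
  proof -
    have sub: "centralizer G g \<subseteq> carrier G" by (auto simp: centralizer_def)
    have "{xs \<in> commuting_tuples G n. set xs \<subseteq> centralizer G g} =
          {xs. set xs \<subseteq> centralizer G g \<and> length xs = n}"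
      using sub by (auto simp: commuting_tuples_def tuples_def intro!: comm[OF g])
    then show ?thesis
      using card_lists_length_eq[OF finite_subset[OF sub fin]] by simp
  qed
  have "sum ?c (carrier G) = sum ?c (carrier G - group_center G) + sum ?c (group_center G)"
    by (rule sum.subset_diff[OF Z fin])
  then show ?thesis
    unfolding card_commuting_tuples_Suc_sum[OF fin] by (simp add: central noncentral)
qed

end

section \<open>Commutation under isoclinism\<close>

context group
begin

lemma group_center_closed: "z \<in> group_center G \<Longrightarrow> z \<in> carrier G"
  by (simp add: group_center_def)

lemma group_center_commute: "z \<in> group_center G \<Longrightarrow> x \<in> carrier G \<Longrightarrow> z \<otimes> x = x \<otimes> z"
  unfolding group_center_def by blast

lemma group_centerI:
  "\<lbrakk>z \<in> carrier G; \<And>x. x \<in> carrier G \<Longrightarrow> z \<otimes> x = x \<otimes> z\<rbrakk> \<Longrightarrow> z \<in> group_center G"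
  unfolding group_center_def by blast

lemma subgroup_group_center: "subgroup (group_center G) G"
proof
  fix z w assume z: "z \<in> group_center G" and w: "w \<in> group_center G"
  show "z \<otimes> w \<in> group_center G"
  proof (rule group_centerI)
    fix x assume x: "x \<in> carrier G"
    have "z \<otimes> w \<otimes> x = z \<otimes> (x \<otimes> w)"
      using group_center_commute[OF w x] z w x by (simp add: group_center_closed m_assoc)
    also have "\<dots> = x \<otimes> z \<otimes> w"
      using group_center_commute[OF z x] z w x by (simp add: group_center_closed flip: m_assoc)
    finally show "z \<otimes> w \<otimes> x = x \<otimes> (z \<otimes> w)"
      using z w x by (simp add: group_center_closed m_assoc)
  qed (use z w in \<open>simp add: group_center_closed\<close>)
next
  fix z assume z: "z \<in> group_center G"
  show "inv z \<in> group_center G"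
  proof (rule group_centerI)
    fix x assume x: "x \<in> carrier G"
    have "z \<otimes> (x \<otimes> inv z) = x \<otimes> z \<otimes> inv z"
      using group_center_commute[OF z x] z x by (simp add: group_center_closed flip: m_assoc)
    also have "\<dots> = x" using z x by (simp add: group_center_closed m_assoc)
    finally show "inv z \<otimes> x = x \<otimes> inv z"
      using z x by (simp add: group_center_closed inv_solve_left')
  qed (use z in \<open>simp add: group_center_closed\<close>)
next
  show "\<one> \<in> group_center G" by (rule group_centerI) simp_all
qed (rule subsetI, rule group_center_closed)

text \<open>Elements of \<open>G Mod N\<close> are right cosets, whereas \<open>isoclinic\<close>
  speaks of left cosets; for the centre the two agree.\<close>

lemma l_coset_group_center:
  assumes "g \<in> carrier G"
  shows "g <# group_center G = group_center G #> g"
proof -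
  have "z \<otimes> g = g \<otimes> z" if "z \<in> group_center G" for z
    using group_center_commute that assms .
  then show ?thesis by (simp add: l_coset_def r_coset_def)
qed

lemma l_coset_eq_iff:
  assumes "subgroup N G" "g \<in> carrier G" "h \<in> carrier G"
  shows "g <# N = h <# N \<longleftrightarrow> g \<in> h <# N"
proof
  have "g \<in> g <# N"
    using subgroup.one_closed[OF assms(1)] assms(2) by (auto simp: l_coset_def intro!: bexI[of _ \<one>])
  then show "g \<in> h <# N" if "g <# N = h <# N" by (simp add: that)
  show "g <# N = h <# N" if "g \<in> h <# N"
    using l_repr_independence[OF that assms(3,1)] by simp
qed

lemma carrier_FactGroup_center: "carrier (G Mod group_center G) = (\<lambda>g. g <# group_center G) ` carrier G"
  by (auto simp: carrier_FactGroup l_coset_group_center)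

lemma card_l_coset:
  assumes "g \<in> carrier G" "N \<subseteq> carrier G"
  shows "card (g <# N) = card N"
proof -
  have "g <# N = (\<lambda>x. g \<otimes> x) ` N" by (auto simp: l_coset_def)
  moreover have "inj_on (\<lambda>x. g \<otimes> x) N" using assms by (auto simp: inj_on_def subset_iff)
  ultimately show ?thesis by (simp add: card_image)
qed

lemma commutator_eq_one_iff:
  assumes "x \<in> carrier G" "y \<in> carrier G"
  shows "commutator G x y = \<one> \<longleftrightarrow> x \<otimes> y = y \<otimes> x"
proof -
  have "commutator G x y = inv (y \<otimes> x) \<otimes> (x \<otimes> y)"
    using assms by (simp add: commutator_def inv_mult_group m_assoc)
  then show ?thesis using assms by (simp add: inv_solve_left')
qed

text \<open>In the library's convention this is the commutator of \<open>inv x\<close> and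
  \<open>inv y\<close>. Membership matters because \<phi> of an isoclinism is injective only on the
  derived subgroup.\<close>

lemma commutator_in_derived:
  assumes "x \<in> carrier G" "y \<in> carrier G"
  shows "commutator G x y \<in> derived G (carrier G)"
proof -
  have eq: "commutator G x y = inv x \<otimes> inv y \<otimes> inv (inv x) \<otimes> inv (inv y)"
    using assms by (simp add: commutator_def)
  have "commutator G x y \<in> derived_set G (carrier G)"
    unfolding eq by (rule UN_I[of "inv x"], use assms in simp, rule UN_I[of "inv y"]) (use assms in simp_all)
  then show ?thesis unfolding derived_def by (rule generate.incl)
qed

end

text \<open>The map \<open>h\<close> lifts \<theta> to elements by choosing coset representatives
  and need not be a homomorphism. It preserves and reflects commuting because \<phi> is injective
  and matches trivial commutators with trivial ones; its fibres over central cosets are central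
  cosets because \<theta> is bijective.\<close>

lemma isoclinic_commuting_map:
  assumes G: "group G" and H: "group H" and iso: "isoclinic G H"
  obtains h where "h \<in> carrier G \<rightarrow> carrier H"
    and "\<And>x y. \<lbrakk>x \<in> carrier G; y \<in> carrier G\<rbrakk> \<Longrightarrow>
           x \<otimes>\<^bsub>G\<^esub> y = y \<otimes>\<^bsub>G\<^esub> x \<longleftrightarrow> h x \<otimes>\<^bsub>H\<^esub> h y = h y \<otimes>\<^bsub>H\<^esub> h x"
    and "\<And>y. y \<in> carrier H \<Longrightarrow>
           card {x \<in> carrier G. h x \<in> y <#\<^bsub>H\<^esub> group_center H} = card (group_center G)"
proof -
  interpret G: group G by (rule G)
  interpret H: group H by (rule H)
  from iso[unfolded isoclinic_def] obtain \<theta> \<phi> where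
    "\<theta> \<in> iso (G Mod group_center G) (H Mod group_center H) \<and>
     \<phi> \<in> iso (derived_group G) (derived_group H) \<and>
     (\<forall>g\<^sub>1 \<in> carrier G. \<forall>g\<^sub>2 \<in> carrier G. \<forall>h\<^sub>1 \<in> carrier H. \<forall>h\<^sub>2 \<in> carrier H.
        \<theta> (g\<^sub>1 <#\<^bsub>G\<^esub> group_center G) = h\<^sub>1 <#\<^bsub>H\<^esub> group_center H \<and>
        \<theta> (g\<^sub>2 <#\<^bsub>G\<^esub> group_center G) = h\<^sub>2 <#\<^bsub>H\<^esub> group_center H \<longrightarrow>
        \<phi> (commutator G g\<^sub>1 g\<^sub>2) = commutator H h\<^sub>1 h\<^sub>2)"
    by (elim exE)
  then have \<theta>: "\<theta> \<in> iso (G Mod group_center G) (H Mod group_center H)"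
    and \<phi>: "\<phi> \<in> iso (derived_group G) (derived_group H)"
    and comp: "\<And>g\<^sub>1 g\<^sub>2 h\<^sub>1 h\<^sub>2. \<lbrakk>g\<^sub>1 \<in> carrier G; g\<^sub>2 \<in> carrier G; h\<^sub>1 \<in> carrier H; h\<^sub>2 \<in> carrier H;
       \<theta> (g\<^sub>1 <#\<^bsub>G\<^esub> group_center G) = h\<^sub>1 <#\<^bsub>H\<^esub> group_center H;
       \<theta> (g\<^sub>2 <#\<^bsub>G\<^esub> group_center G) = h\<^sub>2 <#\<^bsub>H\<^esub> group_center H\<rbrakk> \<Longrightarrow>
       \<phi> (commutator G g\<^sub>1 g\<^sub>2) = commutator H h\<^sub>1 h\<^sub>2"
    by simp_all
  have \<theta>_bij: "bij_betw \<theta> ((\<lambda>g. g <#\<^bsub>G\<^esub> group_center G) ` carrier G)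
      ((\<lambda>g. g <#\<^bsub>H\<^esub> group_center H) ` carrier H)"
    using \<theta> by (simp add: iso_def G.carrier_FactGroup_center H.carrier_FactGroup_center)
  have "\<forall>g \<in> carrier G. \<exists>k \<in> carrier H. \<theta> (g <#\<^bsub>G\<^esub> group_center G) = k <#\<^bsub>H\<^esub> group_center H"
    using bij_betwE[OF \<theta>_bij] by blast
  then have "\<forall>g \<in> carrier G. \<exists>k. k \<in> carrier H \<and> \<theta> (g <#\<^bsub>G\<^esub> group_center G) = k <#\<^bsub>H\<^esub> group_center H"
    by (simp only: Bex_def)
  from bchoice[OF this] obtain h where h: "\<And>g. g \<in> carrier G \<Longrightarrow> h g \<in> carrier H"
    "\<And>g. g \<in> carrier G \<Longrightarrow> \<theta> (g <#\<^bsub>G\<^esub> group_center G) = h g <#\<^bsub>H\<^esub> group_center H"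
    by (elim exE) (rule that, simp_all only: Ball_def)
  have inj: "inj_on \<phi> (derived G (carrier G))"
    using \<phi> by (simp add: iso_def bij_betw_def derived_group_def)
  \<comment> \<open>Compatibility with commutators, applied to the identity twice, already gives
    this.\<close>
  have one: "\<phi> \<one>\<^bsub>G\<^esub> = \<one>\<^bsub>H\<^esub>"
  proof -
    have "\<phi> (commutator G \<one>\<^bsub>G\<^esub> \<one>\<^bsub>G\<^esub>) = commutator H (h \<one>\<^bsub>G\<^esub>) (h \<one>\<^bsub>G\<^esub>)"
      by (rule comp) (simp_all add: h)
    moreover have "commutator G \<one>\<^bsub>G\<^esub> \<one>\<^bsub>G\<^esub> = \<one>\<^bsub>G\<^esub>" by (simp add: G.commutator_eq_one_iff)
    moreover have "commutator H (h \<one>\<^bsub>G\<^esub>) (h \<one>\<^bsub>G\<^esub>) = \<one>\<^bsub>H\<^esub>"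
      by (simp add: H.commutator_eq_one_iff h)
    ultimately show ?thesis by simp
  qed
  have one_derived: "\<one>\<^bsub>G\<^esub> \<in> derived G (carrier G)"
    unfolding derived_def by (rule generate.one)
  have "x \<otimes>\<^bsub>G\<^esub> y = y \<otimes>\<^bsub>G\<^esub> x \<longleftrightarrow> h x \<otimes>\<^bsub>H\<^esub> h y = h y \<otimes>\<^bsub>H\<^esub> h x"
    if xy: "x \<in> carrier G" "y \<in> carrier G" for x y
  proof -
    have "commutator G x y = \<one>\<^bsub>G\<^esub> \<longleftrightarrow> \<phi> (commutator G x y) = \<phi> \<one>\<^bsub>G\<^esub>"
      using inj_on_eq_iff[OF inj G.commutator_in_derived[OF xy] one_derived] by simp
    moreover have "\<phi> (commutator G x y) = commutator H (h x) (h y)"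
      by (rule comp) (use xy h in auto)
    ultimately show ?thesis
      by (simp only: one G.commutator_eq_one_iff[OF xy] H.commutator_eq_one_iff[OF h(1)[OF xy(1)] h(1)[OF xy(2)]])
  qed
  note commute_iff = this
  have "card {x \<in> carrier G. h x \<in> y <#\<^bsub>H\<^esub> group_center H} = card (group_center G)"
    if y: "y \<in> carrier H" for y
  proof -
    \<comment> \<open>By surjectivity of \<theta>; the fibre over the coset of \<open>y\<close> will
      be the coset of \<open>g\<close>.\<close>
    obtain g where g: "g \<in> carrier G" "\<theta> (g <#\<^bsub>G\<^esub> group_center G) = y <#\<^bsub>H\<^esub> group_center H"
    proof -
      have "y <#\<^bsub>H\<^esub> group_center H \<in> \<theta> ` (\<lambda>g. g <#\<^bsub>G\<^esub> group_center G) ` carrier G"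
        unfolding bij_betw_imp_surj_on[OF \<theta>_bij] using y by (rule imageI)
      then show thesis using that by auto
    qed
    have "h x \<in> y <#\<^bsub>H\<^esub> group_center H \<longleftrightarrow> x \<in> g <#\<^bsub>G\<^esub> group_center G" if x: "x \<in> carrier G" for x
    proof -
      have "h x \<in> y <#\<^bsub>H\<^esub> group_center H \<longleftrightarrow>
          h x <#\<^bsub>H\<^esub> group_center H = y <#\<^bsub>H\<^esub> group_center H"
        using H.l_coset_eq_iff[OF H.subgroup_group_center, of "h x" y] h(1)[OF x] y by simp
      also have "\<dots> \<longleftrightarrow> \<theta> (x <#\<^bsub>G\<^esub> group_center G) = \<theta> (g <#\<^bsub>G\<^esub> group_center G)"
        by (simp only: h(2)[OF x] g(2))
      also have "\<dots> \<longleftrightarrow> x <#\<^bsub>G\<^esub> group_center G = g <#\<^bsub>G\<^esub> group_center G"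
        by (rule inj_on_eq_iff[OF bij_betw_imp_inj_on[OF \<theta>_bij]]) (use x g in auto)
      finally show ?thesis
        using x g by (simp add: G.l_coset_eq_iff G.subgroup_group_center)
    qed
    then have "{x \<in> carrier G. h x \<in> y <#\<^bsub>H\<^esub> group_center H} = g <#\<^bsub>G\<^esub> group_center G"
      using G.l_coset_subset_G[OF subgroup.subset[OF G.subgroup_group_center] g(1)] by blast
    then show ?thesis
      using G.card_l_coset[OF g(1) subgroup.subset[OF G.subgroup_group_center]] by simp
  qed
  note fibre = this
  show thesis
  proof (rule that[of h])
    show "h \<in> carrier G \<rightarrow> carrier H" using h(1) by (rule funcsetI)
  qed (fact commute_iff, fact fibre)
qed

section \<open>Powers of elements with central commutator\<close>

lemma (in group) int_pow_cong:
  assumes "x \<in> carrier G" "x [^] n = \<one>" "[i = j] (mod int n)"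
  shows "x [^] i = x [^] j"
proof -
  obtain k where "i = j + int n * k"
    using assms(3) by (metis cong_iff_lin cong_sym)
  moreover have "x [^] (int n * k) = \<one>"
    using assms(1,2) by (simp add: int_pow_pow[symmetric] int_pow_int)
  ultimately show ?thesis using assms(1) by (simp add: int_pow_mult)
qed

lemma (in group) int_pow_conj:
  assumes "g \<in> carrier G" "x \<in> carrier G"
  shows "(g \<otimes> x \<otimes> inv g) [^] (i :: int) = g \<otimes> x [^] i \<otimes> inv g"
proof -
  have "(\<lambda>x. g \<otimes> x \<otimes> inv g) \<in> hom G G"
    using assms(1) by (intro homI) (simp_all add: m_assoc, simp add: m_assoc[symmetric])
  then show ?thesis
    using hom_int_pow[of "\<lambda>x. g \<otimes> x \<otimes> inv g" G G x i] assms(2) is_group by simp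
qed

text \<open>Read the hypothesis as a conjugation, \<open>x y x^-1 = y z\<close>, and raise it to the
  power \<open>j\<close>; the right side splits because \<open>y\<close> and \<open>z\<close>
  commute.\<close>

lemma (in group) central_commutator_int_pow_right:
  assumes c: "x \<in> carrier G" "y \<in> carrier G" "z \<in> carrier G"
    and xy: "x \<otimes> y = y \<otimes> x \<otimes> z" and zx: "z \<otimes> x = x \<otimes> z" and zy: "z \<otimes> y = y \<otimes> z"
  shows "x \<otimes> y [^] (j :: int) = y [^] j \<otimes> x \<otimes> z [^] j"
proof -
  have zjx: "z [^] j \<otimes> x = x \<otimes> z [^] j"
    using int_pow_conj[OF c(1) c(3), of j] c zx by (metis int_pow_closed inv_solve_right' m_closed)
  have "x \<otimes> y \<otimes> inv x = y \<otimes> z"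
    using c xy zx by (simp add: inv_solve_right') (simp add: m_assoc)
  then have "x \<otimes> y [^] j \<otimes> inv x = y [^] j \<otimes> z [^] j"
    using int_pow_conj[OF c(1,2), of j] int_pow_mult_distrib[OF zy[symmetric] c(2,3), of j] by simp
  then have "x \<otimes> y [^] j = y [^] j \<otimes> z [^] j \<otimes> x"
    using c by (metis int_pow_closed inv_solve_right' m_closed)
  then show ?thesis using c zjx by (simp add: m_assoc)
qed

lemma (in group) commute_int_pow:
  assumes "x \<in> carrier G" "y \<in> carrier G" "x \<otimes> y = y \<otimes> x"
  shows "x [^] (i :: int) \<otimes> y [^] (j :: int) = y [^] j \<otimes> x [^] i"
proof -
  \<comment> \<open>The preceding lemma with trivial commutator; it is used once for each of the two
    exponents.\<close>
  have *: "u \<otimes> v [^] k = v [^] k \<otimes> u"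
    if "u \<in> carrier G" "v \<in> carrier G" "u \<otimes> v = v \<otimes> u" for u v and k :: int
    using central_commutator_int_pow_right[of u v \<one> k] that by simp
  from *[OF assms(2,1)] *[of "x [^] i" y] show ?thesis using assms by simp
qed

lemma (in group) central_commutator_int_pow:
  assumes c: "x \<in> carrier G" "y \<in> carrier G" "z \<in> carrier G"
    and xy: "x \<otimes> y = y \<otimes> x \<otimes> z" and zx: "z \<otimes> x = x \<otimes> z" and zy: "z \<otimes> y = y \<otimes> z"
  shows "x [^] (i :: int) \<otimes> y [^] (j :: int) = y [^] j \<otimes> x [^] i \<otimes> z [^] (i * j)"
proof -
  have zj: "inv (z [^] j) \<otimes> x = x \<otimes> inv (z [^] j)" "inv (z [^] j) \<otimes> y [^] j = y [^] j \<otimes> inv (z [^] j)"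
    using commute_int_pow[OF c(3,1) zx, of "- j" 1] commute_int_pow[OF c(3,2) zy, of "- j" j] c
    by (simp_all add: int_pow_neg)
  have "y [^] j \<otimes> x = x \<otimes> y [^] j \<otimes> inv (z [^] j)"
    using central_commutator_int_pow_right[OF c xy zx zy, of j] c
    by (simp add: inv_solve_right)
  also have "\<dots> = x \<otimes> y [^] j \<otimes> z [^] (- j)" using c by (simp add: int_pow_neg)
  finally have yx: "y [^] j \<otimes> x = x \<otimes> y [^] j \<otimes> z [^] (- j)" .
  \<comment> \<open>The one-sided lemma a second time, with \<open>y^j\<close> and \<open>x\<close>
    as the pair and \<open>z^(-j)\<close> as their central commutator.\<close>
  have "y [^] j \<otimes> x [^] i = x [^] i \<otimes> y [^] j \<otimes> (z [^] (- j)) [^] i"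
    by (rule central_commutator_int_pow_right) (use c yx zj in \<open>auto simp: int_pow_neg\<close>)
  also have "(z [^] (- j)) [^] i = inv (z [^] (i * j))"
    using c by (simp add: int_pow_pow mult.commute flip: int_pow_neg)
  finally show ?thesis
    using c by (simp add: inv_solve_right)
qed

section \<open>Normal forms in $\Phi_4(1^5)$\<close>

type_synonym int5 = "int \<times> int \<times> int \<times> int \<times> int"

text \<open>
  The exponents of \<open>\<alpha>\<^sup>a \<alpha>\<^sub>1\<^sup>b \<alpha>\<^sub>2\<^sup>c \<beta>\<^sub>1\<^sup>d \<beta>\<^sub>2\<^sup>e\<close>, kept in the integers; \<open>phi4_mult\<close> comes from
  \<open>\<alpha>\<^sub>1\<^sup>b \<alpha>\<^sup>a = \<alpha>\<^sup>a \<alpha>\<^sub>1\<^sup>b \<beta>\<^sub>1\<^sup>b\<^sup>a\<close>.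
\<close>

fun phi4_mult :: "int5 \<Rightarrow> int5 \<Rightarrow> int5" where
  "phi4_mult (a, b, c, d, e) (a', b', c', d', e') =
     (a + a', b + b', c + c', d + d' + b * a', e + e' + c * a')"

fun cong5 :: "nat \<Rightarrow> int5 \<Rightarrow> int5 \<Rightarrow> bool" where
  "cong5 p (a, b, c, d, e) (a', b', c', d', e') \<longleftrightarrow>
     [a = a'] (mod int p) \<and> [b = b'] (mod int p) \<and> [c = c'] (mod int p) \<and>
     [d = d'] (mod int p) \<and> [e = e'] (mod int p)"

lemma phi4_mult_assoc: "phi4_mult (phi4_mult u v) w = phi4_mult u (phi4_mult v w)"
  by (cases u; cases v; cases w) (simp add: algebra_simps)

lemma cong5_refl [simp]: "cong5 p u u"
  by (cases u) simp

lemma cong5_sym: "cong5 p u v \<Longrightarrow> cong5 p v u"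
  by (cases u; cases v) (simp add: cong_sym)

lemma cong5_trans: "cong5 p u v \<Longrightarrow> cong5 p v w \<Longrightarrow> cong5 p u w"
  by (cases u; cases v; cases w) (auto intro: cong_trans)

lemma cong5_mult: "cong5 p u u' \<Longrightarrow> cong5 p v v' \<Longrightarrow> cong5 p (phi4_mult u v) (phi4_mult u' v')"
  by (cases u; cases v; cases u'; cases v') (auto intro!: cong_add cong_mult)

fun letter_exps :: "phi4_gen \<times> bool \<Rightarrow> int5" where
  "letter_exps (Alpha, s) = (if s then 1 else -1, 0, 0, 0, 0)"
| "letter_exps (Alpha1, s) = (0, if s then 1 else -1, 0, 0, 0)"
| "letter_exps (Alpha2, s) = (0, 0, if s then 1 else -1, 0, 0)"
| "letter_exps (Beta1, s) = (0, 0, 0, if s then 1 else -1, 0)"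
| "letter_exps (Beta2, s) = (0, 0, 0, 0, if s then 1 else -1)"

primrec word_exps :: "phi4_gen word \<Rightarrow> int5" where
  "word_exps [] = (0, 0, 0, 0, 0)"
| "word_exps (l # w) = phi4_mult (letter_exps l) (word_exps w)"

lemma phi4_mult_zero_left [simp]: "phi4_mult (0, 0, 0, 0, 0) u = u"
  by (cases u) simp

lemma word_exps_append: "word_exps (u @ v) = phi4_mult (word_exps u) (word_exps v)"
  by (induction u) (simp_all add: phi4_mult_assoc)

lemma word_exps_pow_word:
  "word_exps (pow_word g n) =
     (case g of Alpha \<Rightarrow> (int n, 0, 0, 0, 0) | Alpha1 \<Rightarrow> (0, int n, 0, 0, 0)
      | Alpha2 \<Rightarrow> (0, 0, int n, 0, 0) | Beta1 \<Rightarrow> (0, 0, 0, int n, 0) | Beta2 \<Rightarrow> (0, 0, 0, 0, int n))"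
  unfolding pow_word_def by (induction n) (cases g; simp)+

lemma word_exps_cancel: "word_exps [(x, b), (x, \<not> b)] = (0, 0, 0, 0, 0)"
  by (cases x) auto

text \<open>The defining relations hold modulo \<open>p\<close> in the explicit model given by
  \<open>phi4_mult\<close>.\<close>

lemma word_exps_relation:
  assumes "(r, s) \<in> phi4_rels p"
  shows "cong5 p (word_exps r) (word_exps s)"
proof -
  have "cong5 p (word_exps (comm_word Alpha1 Alpha)) (word_exps (gen Beta1))"
    "cong5 p (word_exps (comm_word Alpha2 Alpha)) (word_exps (gen Beta2))"
    by (simp_all add: comm_word_def gen_def)
  moreover have "cong5 p (word_exps (pow_word x p)) (word_exps [])" for x
    by (cases x) (simp_all add: word_exps_pow_word cong_0_iff)
  moreover have "cong5 p (word_exps (comm_word x y)) (word_exps [])"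
    if "{x, y} \<noteq> {Alpha1, Alpha}" "{x, y} \<noteq> {Alpha2, Alpha}" for x y
    using that by (cases x; cases y) (auto simp: comm_word_def)
  ultimately show ?thesis using assms unfolding phi4_rels_def by blast
qed

text \<open>Exponents modulo \<open>p\<close> are thus invariants of group elements, so distinct
  normal forms stay distinct in the presented group.\<close>

lemma word_eq_imp_cong5: "word_eq (phi4_rels p) u v \<Longrightarrow> cong5 p (word_exps u) (word_exps v)"
proof (induction rule: word_eq.induct)
  case (cancel u x b v)
  then show ?case unfolding word_exps_append word_exps_cancel by simp
next
  case (relation r s u v)
  then show ?case unfolding word_exps_append by (intro cong5_mult cong5_refl; rule word_exps_relation)
qed (auto intro: cong5_sym cong5_trans)

text \<open>Five elements of an arbitrary group that satisfy the relations, with \<open>x\<close>,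
  \<open>x1\<close>, \<open>x2\<close>, \<open>y1\<close>, \<open>y2\<close> for \<alpha>,
  \<open>\<alpha>\<^sub>1\<close>, \<open>\<alpha>\<^sub>2\<close>, \<open>\<beta>\<^sub>1\<close>,
  \<open>\<beta>\<^sub>2\<close>. Commutator relations appear as rules for exchanging neighbours,
  ready for collecting powers.\<close>

locale phi4_relations = group G for G (structure) +
  fixes p :: nat and x x1 x2 y1 y2
  assumes gen_closed [simp]: "x \<in> carrier G" "x1 \<in> carrier G" "x2 \<in> carrier G"
      "y1 \<in> carrier G" "y2 \<in> carrier G"
    and gen_comm: "x1 \<otimes> x = x \<otimes> x1 \<otimes> y1" "x2 \<otimes> x = x \<otimes> x2 \<otimes> y2"
    and gen_commute: "x2 \<otimes> x1 = x1 \<otimes> x2"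
      "y1 \<otimes> x = x \<otimes> y1" "y1 \<otimes> x1 = x1 \<otimes> y1" "y1 \<otimes> x2 = x2 \<otimes> y1"
      "y2 \<otimes> x = x \<otimes> y2" "y2 \<otimes> x1 = x1 \<otimes> y2" "y2 \<otimes> x2 = x2 \<otimes> y2" "y2 \<otimes> y1 = y1 \<otimes> y2"
    and gen_pow: "x [^] p = \<one>" "x1 [^] p = \<one>" "x2 [^] p = \<one>" "y1 [^] p = \<one>" "y2 [^] p = \<one>"
begin

definition normal_form :: "int5 \<Rightarrow> 'a" where
  "normal_form = (\<lambda>(a, b, c, d, e). x [^] a \<otimes> (x1 [^] b \<otimes> (x2 [^] c \<otimes> (y1 [^] d \<otimes> y2 [^] e))))"

lemma left_commute:
  "\<lbrakk>u \<otimes> v = v \<otimes> u; u \<in> carrier G; v \<in> carrier G; w \<in> carrier G\<rbrakk> \<Longrightarrow> u \<otimes> (v \<otimes> w) = v \<otimes> (u \<otimes> w)"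
  by (metis m_assoc)

text \<open>Collection to the left: moving the power of \<open>x\<close> in the second factor past
  \<open>x1\<close> and \<open>x2\<close> creates the powers of \<open>y1\<close> and
  \<open>y2\<close> recorded in \<open>phi4_mult\<close>; all other exchanges are free.\<close>

lemma normal_form_mult: "normal_form u \<otimes> normal_form v = normal_form (phi4_mult u v)"
proof -
  note comm = gen_commute[THEN commute_int_pow[rotated -1], simplified]
  note lcomm = comm[THEN left_commute, simplified]
  have x1x: "x1 [^] (i :: int) \<otimes> x [^] (j :: int) = x [^] j \<otimes> (x1 [^] i \<otimes> y1 [^] (i * j))" for i j
    using central_commutator_int_pow[OF _ _ _ gen_comm(1), of i j] gen_commute by (simp add: m_assoc)
  have x2x: "x2 [^] (i :: int) \<otimes> x [^] (j :: int) = x [^] j \<otimes> (x2 [^] i \<otimes> y2 [^] (i * j))" for i j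
    using central_commutator_int_pow[OF _ _ _ gen_comm(2), of i j] gen_commute by (simp add: m_assoc)
  \<comment> \<open>Products are kept associated to the right, so each exchange rule also needs a
    version with a remaining factor \<open>w\<close>.\<close>
  have x1x_left: "x1 [^] (i :: int) \<otimes> (x [^] (j :: int) \<otimes> w) =
      x [^] j \<otimes> (x1 [^] i \<otimes> (y1 [^] (i * j) \<otimes> w))" if "w \<in> carrier G" for i j w
    using that by (simp add: x1x flip: m_assoc)
  have x2x_left: "x2 [^] (i :: int) \<otimes> (x [^] (j :: int) \<otimes> w) =
      x [^] j \<otimes> (x2 [^] i \<otimes> (y2 [^] (i * j) \<otimes> w))" if "w \<in> carrier G" for i j w
    using that by (simp add: x2x flip: m_assoc)
  have merge: "g [^] (i :: int) \<otimes> g [^] (j :: int) = g [^] (i + j)" if "g \<in> carrier G" for g i j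
    using that by (simp add: int_pow_mult)
  have merge_left: "g [^] (i :: int) \<otimes> (g [^] (j :: int) \<otimes> w) = g [^] (i + j) \<otimes> w"
    if "g \<in> carrier G" "w \<in> carrier G" for g i j w
    using that by (simp add: int_pow_mult m_assoc)
  show ?thesis
    by (cases u; cases v)
      (simp add: normal_form_def m_assoc comm lcomm x1x x2x x1x_left x2x_left merge merge_left, simp add: ac_simps)
qed

lemma normal_form_cong:
  assumes "cong5 p u v"
  shows "normal_form u = normal_form v"
proof -
  obtain a b c d e where u: "u = (a, b, c, d, e)" by (cases u)
  obtain a' b' c' d' e' where v: "v = (a', b', c', d', e')" by (cases v)
  have "x [^] a = x [^] a'" "x1 [^] b = x1 [^] b'" "x2 [^] c = x2 [^] c'"
    "y1 [^] d = y1 [^] d'" "y2 [^] e = y2 [^] e'"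
    using assms gen_pow by (auto simp: u v intro: int_pow_cong)
  then show ?thesis by (simp add: normal_form_def u v)
qed

end

section \<open>Word classes and the word problem in the presented group\<close>

definition word_class :: "('x word \<times> 'x word) set \<Rightarrow> 'x word \<Rightarrow> 'x word set" where
  "word_class R u = {w. word_eq R u w}"

lemma word_class_eq_iff: "word_class R u = word_class R v \<longleftrightarrow> word_eq R u v"
  unfolding word_class_def by (auto intro: word_eq.refl word_eq.sym word_eq.trans)

lemma word_class_closed [simp]: "word_class R u \<in> carrier (presented_group R)"
  by (simp add: word_class_def presented_group_carrier)

lemma word_class_append:
  "word_class R u \<otimes>\<^bsub>presented_group R\<^esub> word_class R v = word_class R (u @ v)"
  by (simp add: word_class_def presented_group_mult)

lemma word_class_one: "\<one>\<^bsub>presented_group R\<^esub> = word_class R []"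
  by (simp add: word_class_def presented_group_one)

lemma word_class_inv: "inv\<^bsub>presented_group R\<^esub> (word_class R [(g, s)]) = word_class R [(g, \<not> s)]"
proof -
  interpret group "presented_group R" by (rule group_presented_group)
  show ?thesis
    using word_eq.cancel[of R "[]" g "\<not> s" "[]"]
    by (intro inv_equality) (simp_all add: word_class_append word_class_one word_class_eq_iff)
qed

lemma word_class_gen_pow: "word_class R (gen g) [^]\<^bsub>presented_group R\<^esub> n = word_class R (pow_word g n)"
proof (induction n)
  case 0
  interpret group "presented_group R" by (rule group_presented_group)
  show ?case by (simp add: pow_word_def word_class_one)
next
  case (Suc n)
  interpret group "presented_group R" by (rule group_presented_group)
  show ?case
    by (simp add: Suc word_class_append)
      (simp add: pow_word_def gen_def replicate_append_same)
qed

text \<open>Free cancellation in \<open>y x x^-1 y^-1 x y\<close>; it turns a relation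
  \<open>[x, y] = s\<close> into the exchange rule \<open>x y = y x s\<close>.\<close>

lemma word_eq_comm_word: "word_eq R (gen y @ gen x @ comm_word x y) (gen x @ gen y)"
proof -
  have "word_eq R ([(y, True)] @ [(x, True), (x, False)] @ [(y, False), (x, True), (y, True)])
          ([(y, True)] @ [(y, False), (x, True), (y, True)])"
    using word_eq.cancel[of R "[(y, True)]" x True] by simp
  moreover have "word_eq R ([] @ [(y, True), (y, False)] @ [(x, True), (y, True)])
      ([] @ [(x, True), (y, True)])"
    using word_eq.cancel[of R "[]" y True] by simp
  ultimately show ?thesis by (auto simp: gen_def comm_word_def intro: word_eq.trans)
qed

lemma word_class_relation: "(r, s) \<in> R \<Longrightarrow> word_class R r = word_class R s"
  using word_eq.relation[of r s R "[]" "[]"] by (simp add: word_class_eq_iff)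

lemma word_class_comm:
  assumes "(comm_word x y, s) \<in> R"
  shows "word_class R (gen x) \<otimes>\<^bsub>presented_group R\<^esub> word_class R (gen y) =
         word_class R (gen y) \<otimes>\<^bsub>presented_group R\<^esub> word_class R (gen x) \<otimes>\<^bsub>presented_group R\<^esub> word_class R s"
  using word_eq_comm_word[of R y x] word_eq.relation[OF assms, of "gen y @ gen x" "[]"]
  by (simp add: word_class_append word_class_eq_iff) (meson word_eq.sym word_eq.trans)

lemma phi4_relations_phi4:
  "phi4_relations (phi4_1_5 p) p (word_class (phi4_rels p) (gen Alpha))
     (word_class (phi4_rels p) (gen Alpha1)) (word_class (phi4_rels p) (gen Alpha2))
     (word_class (phi4_rels p) (gen Beta1)) (word_class (phi4_rels p) (gen Beta2))"
proof -
  let ?R = "phi4_rels p"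
  interpret group "presented_group ?R" by (rule group_presented_group)
  have comm: "word_class ?R (gen x) \<otimes>\<^bsub>presented_group ?R\<^esub> word_class ?R (gen y) =
      word_class ?R (gen y) \<otimes>\<^bsub>presented_group ?R\<^esub> word_class ?R (gen x)"
    if "{x, y} \<noteq> {Alpha1, Alpha}" "{x, y} \<noteq> {Alpha2, Alpha}" for x y
  proof -
    have "(comm_word x y, []) \<in> ?R" using that by (auto simp: phi4_rels_def)
    from word_class_comm[OF this] show ?thesis by (simp add: word_class_append)
  qed
  have pow: "word_class ?R (gen x) [^]\<^bsub>presented_group ?R\<^esub> p = \<one>\<^bsub>presented_group ?R\<^esub>" for x
    unfolding word_class_gen_pow word_class_one
    by (rule word_class_relation) (auto simp: phi4_rels_def)
  have "(comm_word Alpha1 Alpha, gen Beta1) \<in> ?R" "(comm_word Alpha2 Alpha, gen Beta2) \<in> ?R"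
    by (simp_all add: phi4_rels_def)
  note rels = this[THEN word_class_comm]
  note comms = comm[of Alpha2 Alpha1] comm[of Beta1 Alpha] comm[of Beta1 Alpha1] comm[of Beta1 Alpha2]
    comm[of Beta2 Alpha] comm[of Beta2 Alpha1] comm[of Beta2 Alpha2] comm[of Beta2 Beta1]
  show ?thesis
    unfolding phi4_1_5_def
    by unfold_locales (simp_all add: rels pow comms doubleton_eq_iff)
qed

text \<open>Every element has a normal form: this holds for single letters and passes to words since
  \<open>normal_form\<close> is multiplicative.\<close>

lemma word_class_normal_form:
  "word_class (phi4_rels p) u =
     phi4_relations.normal_form (phi4_1_5 p) (word_class (phi4_rels p) (gen Alpha))
       (word_class (phi4_rels p) (gen Alpha1)) (word_class (phi4_rels p) (gen Alpha2))
       (word_class (phi4_rels p) (gen Beta1)) (word_class (phi4_rels p) (gen Beta2)) (word_exps u)"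
proof -
  interpret phi4_relations "phi4_1_5 p" p "word_class (phi4_rels p) (gen Alpha)"
     "word_class (phi4_rels p) (gen Alpha1)" "word_class (phi4_rels p) (gen Alpha2)"
     "word_class (phi4_rels p) (gen Beta1)" "word_class (phi4_rels p) (gen Beta2)"
    by (rule phi4_relations_phi4)
  have inv: "inv\<^bsub>phi4_1_5 p\<^esub> (word_class (phi4_rels p) (gen g)) = word_class (phi4_rels p) [(g, False)]" for g
    using word_class_inv[of "phi4_rels p" g True] by (simp add: phi4_1_5_def gen_def)
  have closed [simp]: "word_class (phi4_rels p) u \<in> carrier (phi4_1_5 p)" for u
    unfolding phi4_1_5_def by (rule word_class_closed)
  have letter: "word_class (phi4_rels p) [l] = normal_form (letter_exps l)" for l
  proof -
    obtain g s where l: "l = (g, s)" by (cases l)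
    show ?thesis
      unfolding l by (cases g; cases s) (simp_all add: normal_form_def int_pow_neg inv, simp_all add: gen_def)
  qed
  show ?thesis
  proof (induction u)
    case Nil
    show ?case
      using word_class_one[of "phi4_rels p"] by (simp add: normal_form_def flip: phi4_1_5_def)
  next
    case (Cons l u)
    have "word_class (phi4_rels p) (l # u) =
        word_class (phi4_rels p) [l] \<otimes>\<^bsub>phi4_1_5 p\<^esub> word_class (phi4_rels p) u"
      by (simp add: phi4_1_5_def word_class_append)
    then show ?case by (simp add: Cons letter normal_form_mult)
  qed
qed

text \<open>Existence and uniqueness of normal forms combined. Congruent exponents give equal normal
  forms because the generators have \<open>p\<close>-th power one.\<close>

lemma word_eq_phi4_iff: "word_eq (phi4_rels p) u v \<longleftrightarrow> cong5 p (word_exps u) (word_exps v)"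
proof
  assume "cong5 p (word_exps u) (word_exps v)"
  then have "word_class (phi4_rels p) u = word_class (phi4_rels p) v"
    using phi4_relations.normal_form_cong[OF phi4_relations_phi4]
      word_class_normal_form[of p u] word_class_normal_form[of p v] by simp
  then show "word_eq (phi4_rels p) u v" by (simp add: word_class_eq_iff)
qed (rule word_eq_imp_cong5)

section \<open>Coordinates on the central quotient of the presented group\<close>

definition cube :: "nat \<Rightarrow> (int \<times> int \<times> int) set" where
  "cube p = {0..<int p} \<times> {0..<int p} \<times> {0..<int p}"

text \<open>
  A triple \<open>(a, b, c)\<close> stands for the coset of \<open>\<alpha>\<^sup>a \<alpha>\<^sub>1\<^sup>b \<alpha>\<^sub>2\<^sup>c\<close> modulo the centre.
\<close>

fun commute3 :: "nat \<Rightarrow> int \<times> int \<times> int \<Rightarrow> int \<times> int \<times> int \<Rightarrow> bool" where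
  "commute3 p (a, b, c) (a', b', c') \<longleftrightarrow>
     [b * a' = b' * a] (mod int p) \<and> [c * a' = c' * a] (mod int p)"

fun coords5 :: "nat \<Rightarrow> int5 \<Rightarrow> int \<times> int \<times> int" where
  "coords5 p (a, b, c, d, e) = (a mod int p, b mod int p, c mod int p)"

text \<open>The two products can differ only in the last two exponents, by the terms
  \<open>b * a'\<close> against \<open>b' * a\<close> and \<open>c * a'\<close> against
  \<open>c' * a\<close>.\<close>

lemma cong5_mult_commute_iff:
  "cong5 p (phi4_mult u v) (phi4_mult v u) \<longleftrightarrow> commute3 p (coords5 p u) (coords5 p v)"
proof -
  obtain a b c d e where u: "u = (a, b, c, d, e)" by (cases u)
  obtain a' b' c' d' e' where v: "v = (a', b', c', d', e')" by (cases v)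
  have "[d + d' + b * a' = d' + d + b' * a] (mod int p) \<longleftrightarrow> [b * a' = b' * a] (mod int p)"
    "[e + e' + c * a' = e' + e + c' * a] (mod int p) \<longleftrightarrow> [c * a' = c' * a] (mod int p)"
    by (simp_all add: add.commute[of d'] add.commute[of e'] cong_add_lcancel)
  then show ?thesis
    by (simp add: u v add.commute) (simp add: cong_def mod_mult_eq)
qed

lemma coords5_mult_eq_iff:
  "coords5 p (phi4_mult u v) = coords5 p u \<longleftrightarrow> coords5 p v = (0, 0, 0)"
proof -
  have "(a + a') mod int p = a mod int p \<longleftrightarrow> a' mod int p = 0" for a a'
    using cong_add_lcancel_0[of a a' "int p"] by (simp add: cong_def)
  then show ?thesis by (cases u; cases v) simp
qed

lemma phi4_coordinates:
  assumes p: "p > 0"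
  obtains F where "F ` carrier (phi4_1_5 p) = cube p"
    and "\<And>K L. \<lbrakk>K \<in> carrier (phi4_1_5 p); L \<in> carrier (phi4_1_5 p)\<rbrakk> \<Longrightarrow>
           K \<otimes>\<^bsub>phi4_1_5 p\<^esub> L = L \<otimes>\<^bsub>phi4_1_5 p\<^esub> K \<longleftrightarrow> commute3 p (F K) (F L)"
    and "\<And>K L. \<lbrakk>K \<in> carrier (phi4_1_5 p); L \<in> carrier (phi4_1_5 p)\<rbrakk> \<Longrightarrow>
           F L = F K \<longleftrightarrow> L \<in> K <#\<^bsub>phi4_1_5 p\<^esub> group_center (phi4_1_5 p)"
proof -
  let ?P = "phi4_1_5 p" and ?cl = "word_class (phi4_rels p)"
  interpret group ?P unfolding phi4_1_5_def by (rule group_presented_group)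
  have carr: "carrier ?P = range ?cl"
    unfolding phi4_1_5_def presented_group_carrier by (simp add: word_class_def)
  have mult: "?cl u \<otimes>\<^bsub>?P\<^esub> ?cl v = ?cl (u @ v)" for u v
    unfolding phi4_1_5_def by (rule word_class_append)
  \<comment> \<open>The representing word is arbitrary; the next claim shows that the value does not
    depend on it.\<close>
  define F where "F K = coords5 p (word_exps (SOME u. K = ?cl u))" for K
  have F: "F (?cl u) = coords5 p (word_exps u)" for u
  proof -
    have "?cl u = ?cl (SOME v. ?cl u = ?cl v)" using someI[of "\<lambda>v. ?cl u = ?cl v" u] by simp
    then have "cong5 p (word_exps u) (word_exps (SOME v. ?cl u = ?cl v))"
      unfolding word_class_eq_iff by (rule word_eq_imp_cong5)
    moreover have "coords5 p x = coords5 p y" if "cong5 p x y" for x y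
      using that by (cases x; cases y) (auto simp: cong_def)
    ultimately show ?thesis by (simp add: F_def)
  qed
  have comm: "?cl u \<otimes>\<^bsub>?P\<^esub> ?cl v = ?cl v \<otimes>\<^bsub>?P\<^esub> ?cl u \<longleftrightarrow> commute3 p (F (?cl u)) (F (?cl v))" for u v
    by (simp add: mult word_class_eq_iff word_eq_phi4_iff word_exps_append F cong5_mult_commute_iff)
  have image: "F ` carrier ?P = cube p"
  proof
    show "F ` carrier ?P \<subseteq> cube p"
    proof
      fix w assume "w \<in> F ` carrier ?P"
      then obtain u where "w = coords5 p (word_exps u)" by (auto simp: carr F)
      then show "w \<in> cube p" using p by (cases "word_exps u") (auto simp: cube_def)
    qed
    show "cube p \<subseteq> F ` carrier ?P"
    proof
      fix w assume w: "w \<in> cube p"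
      obtain a b c where abc: "w = (a, b, c)" by (cases w)
      have "F (?cl (pow_word Alpha (nat a) @ pow_word Alpha1 (nat b) @ pow_word Alpha2 (nat c))) = w"
        using w by (simp add: F word_exps_append word_exps_pow_word abc cube_def)
      then show "w \<in> F ` carrier ?P" unfolding carr by blast
    qed
  qed
  have center: "?cl u \<in> group_center ?P \<longleftrightarrow> F (?cl u) = (0, 0, 0)" for u
  proof -
    have "?cl u \<in> group_center ?P \<longleftrightarrow> (\<forall>w \<in> cube p. commute3 p (F (?cl u)) w)"
      unfolding group_center_def image[symmetric] by (auto simp: carr comm)
    also have "\<dots> \<longleftrightarrow> F (?cl u) = (0, 0, 0)"
    proof
      assume all: "\<forall>w \<in> cube p. commute3 p (F (?cl u)) w"
      obtain a b c where abc: "F (?cl u) = (a, b, c)" by (cases "F (?cl u)")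
      have "F (?cl u) \<in> cube p" unfolding image[symmetric] carr by simp
      then have mem: "(a, b, c) \<in> cube p" by (simp add: abc)
      show "F (?cl u) = (0, 0, 0)"
      \<comment> \<open>For \<open>p = 1\<close> the cube is a single point and lacks the test
        vectors of the other case.\<close>
      proof (cases "p = 1")
        case True
        then show ?thesis unfolding abc using mem by (simp add: cube_def)
      next
        case False
        \<comment> \<open>Commuting with the first vector forces \<open>b = c = 0\<close>, with the
          second \<open>a = 0\<close>.\<close>
        then have "(1, 0, 0) \<in> cube p" "(0, 1, 0) \<in> cube p" using p by (auto simp: cube_def)
        with all have "commute3 p (a, b, c) (1, 0, 0)" "commute3 p (a, b, c) (0, 1, 0)"
          unfolding abc by blast+
        then show ?thesis using mem by (auto simp: abc cube_def cong_def)
      qed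
    next
      have "commute3 p (0, 0, 0) w" for w by (cases w) simp
      then show "\<forall>w \<in> cube p. commute3 p (F (?cl u)) w" if "F (?cl u) = (0, 0, 0)"
        using that by simp
    qed
    finally show ?thesis .
  qed
  have "F L = F K \<longleftrightarrow> L \<in> K <#\<^bsub>?P\<^esub> group_center ?P"
    if K: "K \<in> carrier ?P" and L: "L \<in> carrier ?P" for K L
  proof -
    obtain u where u: "K = ?cl u" using K carr by blast
    obtain w where w: "inv\<^bsub>?P\<^esub> K \<otimes>\<^bsub>?P\<^esub> L = ?cl w"
    proof -
      have "inv\<^bsub>?P\<^esub> K \<otimes>\<^bsub>?P\<^esub> L \<in> range ?cl" using K L unfolding carr[symmetric] by simp
      then show thesis using that by blast
    qed
    then have L_eq: "L = K \<otimes>\<^bsub>?P\<^esub> ?cl w"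
      using K L unfolding w[symmetric] by (simp flip: m_assoc)
    have "F L = F K \<longleftrightarrow> ?cl w \<in> group_center ?P"
      by (simp add: L_eq u mult F word_exps_append coords5_mult_eq_iff center)
    also have "\<dots> \<longleftrightarrow> L \<in> K <#\<^bsub>?P\<^esub> group_center ?P"
    proof
      assume "L \<in> K <#\<^bsub>?P\<^esub> group_center ?P"
      then obtain z where z: "z \<in> group_center ?P" "L = K \<otimes>\<^bsub>?P\<^esub> z" by (auto simp: l_coset_def)
      then have "z \<in> carrier ?P" by (simp add: group_center_def)
      moreover have "?cl w \<in> carrier ?P" by (simp add: carr)
      ultimately show "?cl w \<in> group_center ?P" using z K L_eq by simp
    qed (auto simp: l_coset_def L_eq)
    finally show ?thesis .
  qed
  note coset = this
  have "K \<otimes>\<^bsub>?P\<^esub> L = L \<otimes>\<^bsub>?P\<^esub> K \<longleftrightarrow> commute3 p (F K) (F L)"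
    if "K \<in> carrier ?P" "L \<in> carrier ?P" for K L
  proof -
    obtain u where "K = ?cl u" using \<open>K \<in> carrier ?P\<close> unfolding carr by (rule rangeE)
    moreover obtain v where "L = ?cl v" using \<open>L \<in> carrier ?P\<close> unfolding carr by (rule rangeE)
    ultimately show ?thesis by (simp only: comm)
  qed
  note comm' = this
  show thesis
    by (rule that[of F]) (fact image, fact comm', fact coset)
qed

section \<open>The commutator pairing on $\mathbb{F}_p^3$\<close>

text \<open>Transfers sums over the group to sums over \<open>cube p\<close>, where each point has
  as many preimages as the centre has elements.\<close>

lemma sum_equal_fibres:
  fixes h :: "'b \<Rightarrow> nat"
  assumes "finite A" "finite B" "f ` A \<subseteq> B" "\<And>v. v \<in> B \<Longrightarrow> card {x \<in> A. f x = v} = k"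
  shows "(\<Sum>x\<in>A. h (f x)) = k * (\<Sum>v\<in>B. h v)"
proof -
  have "(\<Sum>x\<in>A. h (f x)) = (\<Sum>v\<in>B. \<Sum>x\<in>{x \<in> A. f x = v}. h (f x))"
    by (rule sum.group[OF assms(1-3), symmetric])
  also have "\<dots> = (\<Sum>v\<in>B. k * h v)"
    by (rule sum.cong) (simp_all add: assms(4))
  finally show ?thesis by (simp add: sum_distrib_left)
qed

lemma finite_cube [simp]: "finite (cube p)"
  by (simp add: cube_def)

lemma card_cube: "card (cube p) = p ^ 3"
  by (simp add: cube_def power3_eq_cube)

lemma commute3_zero [simp]: "commute3 p (0, 0, 0) w"
  by (cases w) simp

lemma coprime_residue:
  assumes "Factorial_Ring.prime p" "0 < a" "a < int p"
  shows "coprime a (int p)"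
proof -
  have "\<not> int p dvd a" using assms(2,3) zdvd_imp_le by force
  then have "coprime (int p) a" using assms(1) by (intro prime_imp_coprime) simp_all
  then show ?thesis by (simp add: coprime_commute)
qed

lemma cong_mult_eq_zero_iff:
  assumes "Factorial_Ring.prime p" "0 < a" "a < int p" "0 \<le> b" "b < int p"
  shows "[a * b = 0] (mod int p) \<longleftrightarrow> b = 0"
  using cong_mult_lcancel[OF coprime_residue[OF assms(1-3)], of b 0] assms(4,5)
  by (auto simp: cong_def)

text \<open>The conditions reduce to \<open>b * a' = 0\<close> and \<open>c * a' = 0\<close> modulo
  \<open>p\<close>, and at least one of \<open>b\<close>, \<open>c\<close> is invertible.\<close>

lemma commute3_zero_fst:
  assumes p: "Factorial_Ring.prime p" and v: "(0, b, c) \<in> cube p" "(b, c) \<noteq> (0, 0)"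
    and w: "w \<in> cube p"
  shows "commute3 p (0, b, c) w \<longleftrightarrow> fst w = 0"
proof -
  obtain a' b' c' where w_eq: "w = (a', b', c')" by (cases w)
  have bounds: "0 \<le> a'" "a' < int p" using w by (auto simp: w_eq cube_def)
  show ?thesis
  proof (cases "b = 0")
    case True
    then have "0 < c" "c < int p" using v by (auto simp: cube_def)
    then show ?thesis using True cong_mult_eq_zero_iff[OF p _ _ bounds, of c] by (simp add: w_eq)
  next
    case False
    then have "0 < b" "b < int p" using v by (auto simp: cube_def)
    then show ?thesis using cong_mult_eq_zero_iff[OF p _ _ bounds, of b] by (auto simp: w_eq)
  qed
qed

text \<open>If \<open>v\<close> has first coordinate zero, so have \<open>w\<close> and
  \<open>w'\<close>, and such vectors commute. Otherwise \<open>w\<close> and \<open>w'\<close> are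
  both multiples of \<open>v\<close> modulo \<open>p\<close>.\<close>

lemma commute3_of_commute3_noncentral:
  assumes p: "Factorial_Ring.prime p" and v: "v \<in> cube p" "v \<noteq> (0, 0, 0)"
    and w: "w \<in> cube p" "commute3 p v w" and w': "w' \<in> cube p" "commute3 p v w'"
  shows "commute3 p w w'"
proof -
  obtain a b c where v_eq: "v = (a, b, c)" by (cases v)
  obtain a1 b1 c1 where w_eq: "w = (a1, b1, c1)" by (cases w)
  obtain a2 b2 c2 where w'_eq: "w' = (a2, b2, c2)" by (cases w')
  show ?thesis
  proof (cases "a = 0")
    case True
    then have "a1 = 0" "a2 = 0"
      using commute3_zero_fst[OF p, of b c w] commute3_zero_fst[OF p, of b c w'] v w w'
      by (auto simp: v_eq w_eq w'_eq)
    then show ?thesis by (simp add: w_eq w'_eq)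
  next
    case False
    then have cop: "coprime a (int p)"
      using coprime_residue[OF p] v by (auto simp: v_eq cube_def)
    \<comment> \<open>Both sides times \<open>a\<close> are congruent to \<open>y * x1 * x2\<close>,
      and \<open>a\<close> is invertible.\<close>
    have cross: "[y1 * x2 = y2 * x1] (mod int p)"
      if "[y * x1 = y1 * a] (mod int p)" "[y * x2 = y2 * a] (mod int p)" for y x1 y1 x2 y2
    proof -
      have e1: "[y * x1 * x2 = y1 * a * x2] (mod int p)" and e2: "[y * x2 * x1 = y2 * a * x1] (mod int p)"
        using that by (auto intro: cong_scalar_right)
      have "y * x2 * x1 = y * x1 * x2" by simp
      with cong_trans[OF cong_sym[OF e1], of "y2 * a * x1"] e2
      have "[y1 * a * x2 = y2 * a * x1] (mod int p)" by simp
      moreover have "y1 * a * x2 = a * (y1 * x2)" "y2 * a * x1 = a * (y2 * x1)" by simp_all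
      ultimately have "[a * (y1 * x2) = a * (y2 * x1)] (mod int p)" by (simp only:)
      then show ?thesis by (simp add: cong_mult_lcancel[OF cop])
    qed
    show ?thesis
      using w(2) w'(2) by (auto simp: v_eq w_eq w'_eq intro: cross)
  qed
qed

text \<open>The solutions form the whole space for the zero vector, the plane of first coordinate
  zero for other vectors in that plane, and the line through \<open>v\<close> for the rest.\<close>

lemma card_commute3:
  assumes p: "Factorial_Ring.prime p" and v: "v \<in> cube p"
  shows "card {w \<in> cube p. commute3 p v w} =
           (if v = (0, 0, 0) then p ^ 3 else if fst v = 0 then p ^ 2 else p)"
proof -
  obtain a b c where v_eq: "v = (a, b, c)" by (cases v)
  consider "v = (0, 0, 0)" | "a = 0" "(b, c) \<noteq> (0, 0)" | "a \<noteq> 0"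
    by (auto simp: v_eq)
  then show ?thesis
  proof cases
    case 1
    then show ?thesis by (simp add: card_cube)
  next
    case 2
    have "{w \<in> cube p. commute3 p v w} = {0} \<times> {0..<int p} \<times> {0..<int p}"
      using commute3_zero_fst[OF p _ 2(2)] v 2 prime_gt_0_nat[OF p]
      by (auto simp: v_eq cube_def)
    then show ?thesis using 2 by (auto simp: v_eq card_cartesian_product power2_eq_square)
  next
    case 3
    have cop: "coprime a (int p)"
      using 3 coprime_residue[OF p] v by (auto simp: v_eq cube_def)
    obtain i where i: "[a * i = 1] (mod int p)" using cong_solve_coprime_int[OF cop] by blast
    \<comment> \<open>With \<open>i\<close> the inverse of \<open>a\<close>, the first coordinate
      \<open>a'\<close> determines the other two, which parametrizes the line.\<close>
    have solve: "[y * a' = y' * a] (mod int p) \<longleftrightarrow> y' = (i * y * a') mod int p"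
      if "0 \<le> y'" "y' < int p" for y a' y'
    proof -
      have "[y * a' = y' * a] (mod int p) \<longleftrightarrow> [a * (i * y * a') = a * y'] (mod int p)"
      proof -
        have "[a * (i * y * a') = y * a'] (mod int p)"
          using cong_scalar_right[OF i, of "y * a'"] by (simp add: mult_ac)
        then show ?thesis unfolding mult.commute[of a y'] by (simp only: cong_def)
      qed
      also have "\<dots> \<longleftrightarrow> y' = (i * y * a') mod int p"
        unfolding cong_mult_lcancel[OF cop] using that by (auto simp: cong_def)
      finally show ?thesis .
    qed
    have "{w \<in> cube p. commute3 p v w} =
          (\<lambda>a'. (a', (i * b * a') mod int p, (i * c * a') mod int p)) ` {0..<int p}"
      using prime_gt_0_nat[OF p] by (auto simp: v_eq cube_def solve image_iff)
    moreover have "inj_on (\<lambda>a'. (a', (i * b * a') mod int p, (i * c * a') mod int p)) {0..<int p}"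
      by (auto simp: inj_on_def)
    ultimately show ?thesis using 3 by (simp add: v_eq card_image)
  qed
qed

lemma sum_cube:
  fixes x y z :: nat
  assumes "p > 0"
  shows "(\<Sum>v\<in>cube p. if v = (0, 0, 0) then x else if fst v = 0 then y else z) =
           x + (p ^ 2 - 1) * y + (p ^ 3 - p ^ 2) * z"
proof -
  \<comment> \<open>The plane of first coordinate zero; the sum splits into the origin, the rest of
    \<open>W\<close>, and the complement of \<open>W\<close>.\<close>
  define W where "W = {0::int} \<times> {0..<int p} \<times> {0..<int p}"
  let ?f = "\<lambda>v :: int \<times> int \<times> int. if v = (0, 0, 0) then x else if fst v = 0 then y else z"
  have sub: "W \<subseteq> cube p" and zero: "(0, 0, 0) \<in> W" and fin: "finite W"
    using assms by (auto simp: W_def cube_def)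
  have cardW: "card W = p ^ 2" by (simp add: W_def card_cartesian_product power2_eq_square)
  have "sum ?f (cube p - W) = (\<Sum>v\<in>cube p - W. z)"
    by (rule sum.cong) (auto simp: W_def cube_def)
  also have "\<dots> = (p ^ 3 - p ^ 2) * z"
    using card_Diff_subset[OF fin sub] by (simp add: cardW card_cube)
  finally have outer: "sum ?f (cube p - W) = (p ^ 3 - p ^ 2) * z" .
  have "sum ?f (W - {(0, 0, 0)}) = (\<Sum>v\<in>W - {(0, 0, 0)}. y)"
    by (rule sum.cong) (auto simp: W_def)
  then have "sum ?f W = x + (p ^ 2 - 1) * y"
    using sum.remove[OF fin zero, of ?f] card_Diff_singleton[OF zero] by (simp add: cardW)
  then show ?thesis
    using sum.subset_diff[OF sub finite_cube, of ?f] outer by simp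
qed

section \<open>Groups in the family $\Phi_4$\<close>

text \<open>Composing the lifted isoclinism with the coordinates of the presented group reduces
  counts in \<open>G\<close> to counts in \<open>cube p\<close>.\<close>

lemma phi4_structure:
  assumes p: "Factorial_Ring.prime p" and G: "group G" and Phi4: "in_Phi4 p G"
  obtains f where "f \<in> carrier G \<rightarrow> cube p"
    and "\<And>x y. \<lbrakk>x \<in> carrier G; y \<in> carrier G\<rbrakk> \<Longrightarrow>
           x \<otimes>\<^bsub>G\<^esub> y = y \<otimes>\<^bsub>G\<^esub> x \<longleftrightarrow> commute3 p (f x) (f y)"
    and "\<And>v. v \<in> cube p \<Longrightarrow> card {x \<in> carrier G. f x = v} = card (group_center G)"
proof -
  let ?P = "phi4_1_5 p"
  have P: "group ?P" unfolding phi4_1_5_def by (rule group_presented_group)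
  have iso: "isoclinic G ?P" using Phi4 by (simp add: in_Phi4_def)
  obtain h
    where h: "h \<in> carrier G \<rightarrow> carrier ?P"
      and h_comm: "\<And>x y. \<lbrakk>x \<in> carrier G; y \<in> carrier G\<rbrakk> \<Longrightarrow>
           x \<otimes>\<^bsub>G\<^esub> y = y \<otimes>\<^bsub>G\<^esub> x \<longleftrightarrow> h x \<otimes>\<^bsub>?P\<^esub> h y = h y \<otimes>\<^bsub>?P\<^esub> h x"
      and h_fibre: "\<And>y. y \<in> carrier ?P \<Longrightarrow>
           card {x \<in> carrier G. h x \<in> y <#\<^bsub>?P\<^esub> group_center ?P} = card (group_center G)"
    by (rule isoclinic_commuting_map[OF G P iso]) (rule that)
  obtain F
    where image: "F ` carrier ?P = cube p"
      and F_comm: "\<And>K L. \<lbrakk>K \<in> carrier ?P; L \<in> carrier ?P\<rbrakk> \<Longrightarrow>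
           K \<otimes>\<^bsub>?P\<^esub> L = L \<otimes>\<^bsub>?P\<^esub> K \<longleftrightarrow> commute3 p (F K) (F L)"
      and F_coset: "\<And>K L. \<lbrakk>K \<in> carrier ?P; L \<in> carrier ?P\<rbrakk> \<Longrightarrow>
           F L = F K \<longleftrightarrow> L \<in> K <#\<^bsub>?P\<^esub> group_center ?P"
    by (rule phi4_coordinates[OF prime_gt_0_nat[OF p]]) (rule that)
  show thesis
  proof (rule that[of "\<lambda>x. F (h x)"])
    show "(\<lambda>x. F (h x)) \<in> carrier G \<rightarrow> cube p"
      unfolding image[symmetric] using funcset_mem[OF h] by blast
    show "x \<otimes>\<^bsub>G\<^esub> y = y \<otimes>\<^bsub>G\<^esub> x \<longleftrightarrow> commute3 p (F (h x)) (F (h y))"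
      if xy: "x \<in> carrier G" "y \<in> carrier G" for x y
      unfolding h_comm[OF xy] by (rule F_comm[OF funcset_mem[OF h xy(1)] funcset_mem[OF h xy(2)]])
    show "card {x \<in> carrier G. F (h x) = v} = card (group_center G)" if v: "v \<in> cube p" for v
    proof -
      obtain K where K: "K \<in> carrier ?P" "v = F K"
        using v unfolding image[symmetric] by (rule imageE)
      have "F (h x) = v \<longleftrightarrow> h x \<in> K <#\<^bsub>?P\<^esub> group_center ?P" if "x \<in> carrier G" for x
        unfolding K(2) by (rule F_coset[OF K(1) funcset_mem[OF h that]])
      then have "{x \<in> carrier G. F (h x) = v} = {x \<in> carrier G. h x \<in> K <#\<^bsub>?P\<^esub> group_center ?P}"
        by blast
      then show ?thesis by (simp only: h_fibre[OF K(1)])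
    qed
  qed
qed

text \<open>The centralizer of \<open>g\<close> is the preimage under \<open>f\<close> of the
  vectors commuting with \<open>f g\<close>, so its order is \<open>k\<close> times the count in
  \<open>card_commute3\<close>.\<close>

lemma phi4_centralizer_sums:
  assumes p: "Factorial_Ring.prime p" and G: "group G" and fin: "finite (carrier G)"
    and Phi4: "in_Phi4 p G"
  defines "k \<equiv> card (group_center G)"
  shows "Coset.order G = k * p ^ 3"
    and "(\<Sum>g\<in>carrier G. card (centralizer G g) ^ n) =
           k * ((k * p ^ 3) ^ n + (p ^ 2 - 1) * (k * p ^ 2) ^ n + (p ^ 3 - p ^ 2) * (k * p) ^ n)"
    and "(\<Sum>g\<in>carrier G - group_center G. card (centralizer G g) ^ n) =
           k * ((p ^ 2 - 1) * (k * p ^ 2) ^ n + (p ^ 3 - p ^ 2) * (k * p) ^ n)"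
    and "\<And>g x y. \<lbrakk>g \<in> carrier G - group_center G; x \<in> centralizer G g; y \<in> centralizer G g\<rbrakk>
           \<Longrightarrow> x \<otimes>\<^bsub>G\<^esub> y = y \<otimes>\<^bsub>G\<^esub> x"
proof -
  interpret group G by (rule G)
  obtain f where f: "f \<in> carrier G \<rightarrow> cube p"
    and comm: "\<And>x y. \<lbrakk>x \<in> carrier G; y \<in> carrier G\<rbrakk> \<Longrightarrow>
           x \<otimes>\<^bsub>G\<^esub> y = y \<otimes>\<^bsub>G\<^esub> x \<longleftrightarrow> commute3 p (f x) (f y)"
    and fibre: "\<And>v. v \<in> cube p \<Longrightarrow> card {x \<in> carrier G. f x = v} = card (group_center G)"
    by (rule phi4_structure[OF p G Phi4]) (rule that)
  have f_cube: "f x \<in> cube p" if "x \<in> carrier G" for x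
    using funcset_mem[OF f that] .
  then have image: "f ` carrier G \<subseteq> cube p" by (rule image_subsetI)
  note sum = sum_equal_fibres[OF fin finite_cube image fibre, folded k_def]
  have mem_centralizer: "x \<in> centralizer G g \<longleftrightarrow> x \<in> carrier G \<and> commute3 p (f g) (f x)"
    if "g \<in> carrier G" for g x
    using comm[OF that] unfolding centralizer_def by blast
  show order: "Coset.order G = k * p ^ 3"
    using sum[of "\<lambda>_. 1"] by (simp add: Coset.order_def card_cube)
  have k: "k > 0" using order fin order_gt_0_iff_finite by (cases "k = 0") auto
  define c where "c v = (if v = (0, 0, 0) then k * p ^ 3 else if fst v = 0 then k * p ^ 2 else k * p)"
    for v :: "int \<times> int \<times> int"
  have card: "card (centralizer G g) = c (f g)" if g: "g \<in> carrier G" for g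
  proof -
    \<comment> \<open>Written as a sum of zeros and ones so that the fibre formula applies.\<close>
    have "card (centralizer G g) = (\<Sum>x\<in>carrier G. if commute3 p (f g) (f x) then 1 else 0)"
    proof -
      have "centralizer G g = {x \<in> carrier G. commute3 p (f g) (f x)}"
        using mem_centralizer[OF g] by blast
      then show ?thesis by (simp add: fin sum.If_cases Collect_conj_eq)
    qed
    also have "\<dots> = k * (\<Sum>w\<in>cube p. if commute3 p (f g) w then 1 else 0)"
      by (rule sum)
    also have "(\<Sum>w\<in>cube p. if commute3 p (f g) w then 1 else 0) = card {w \<in> cube p. commute3 p (f g) w}"
      by (simp add: sum.If_cases Collect_conj_eq)
    also have "k * \<dots> = c (f g)"
      using card_commute3[OF p f_cube[OF g]] by (simp add: c_def)
    finally show ?thesis .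
  qed
  have center: "g \<in> group_center G \<longleftrightarrow> f g = (0, 0, 0)" if g: "g \<in> carrier G" for g
  proof
    assume "f g = (0, 0, 0)"
    then show "g \<in> group_center G"
      using comm[OF g] by (intro group_centerI g) simp
  next
    assume "g \<in> group_center G"
    then have "centralizer G g = carrier G"
      using group_center_commute[of g] unfolding centralizer_def by blast
    then have "c (f g) = k * p ^ 3" using card[OF g] order by (simp add: Coset.order_def)
    \<comment> \<open>As \<open>k > 0\<close>, the three possible centralizer orders show that the
      full order \<open>k * p ^ 3\<close> occurs only over the origin.\<close>
    moreover have "p ^ 2 < p ^ 3" "p < p ^ 3"
      using prime_gt_1_nat[OF p] power_strict_increasing[of 2 3 p] power_strict_increasing[of 1 3 p]
      by simp_all
    ultimately show "f g = (0, 0, 0)"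
      using k by (auto simp: c_def split: if_splits)
  qed
  show all: "(\<Sum>g\<in>carrier G. card (centralizer G g) ^ n) =
           k * ((k * p ^ 3) ^ n + (p ^ 2 - 1) * (k * p ^ 2) ^ n + (p ^ 3 - p ^ 2) * (k * p) ^ n)"
  proof -
    have "(\<Sum>g\<in>carrier G. card (centralizer G g) ^ n) = (\<Sum>g\<in>carrier G. c (f g) ^ n)"
      by (simp add: card)
    also have "\<dots> = k * (\<Sum>v\<in>cube p. c v ^ n)" by (rule sum)
    also have "(\<Sum>v\<in>cube p. c v ^ n) =
        (\<Sum>v\<in>cube p. if v = (0, 0, 0) then (k * p ^ 3) ^ n
                     else if fst v = 0 then (k * p ^ 2) ^ n else (k * p) ^ n)"
      by (rule sum.cong) (auto simp: c_def)
    finally show ?thesis by (simp only: sum_cube[OF prime_gt_0_nat[OF p]])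
  qed
  have "(\<Sum>g\<in>carrier G. card (centralizer G g) ^ n) =
      (\<Sum>g\<in>carrier G - group_center G. card (centralizer G g) ^ n) +
      (\<Sum>g\<in>group_center G. card (centralizer G g) ^ n)"
    by (rule sum.subset_diff[OF _ fin]) (auto dest: group_center_closed)
  also have "(\<Sum>g\<in>group_center G. card (centralizer G g) ^ n) = k * (k * p ^ 3) ^ n"
  proof -
    have "(\<Sum>g\<in>group_center G. card (centralizer G g) ^ n) = (\<Sum>g\<in>group_center G. (k * p ^ 3) ^ n)"
      by (rule sum.cong) (simp_all add: card center[THEN iffD1] group_center_closed c_def)
    then show ?thesis by (simp add: k_def)
  qed
  finally show "(\<Sum>g\<in>carrier G - group_center G. card (centralizer G g) ^ n) =
           k * ((p ^ 2 - 1) * (k * p ^ 2) ^ n + (p ^ 3 - p ^ 2) * (k * p) ^ n)"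
    unfolding all by (simp add: distrib_left)
  show "x \<otimes>\<^bsub>G\<^esub> y = y \<otimes>\<^bsub>G\<^esub> x"
    if g: "g \<in> carrier G - group_center G" and x: "x \<in> centralizer G g" and y: "y \<in> centralizer G g"
    for g x y
  proof -
    have g': "g \<in> carrier G" "f g \<noteq> (0, 0, 0)" using g center by auto
    have x': "x \<in> carrier G" "commute3 p (f g) (f x)" using mem_centralizer[OF g'(1)] x by auto
    have y': "y \<in> carrier G" "commute3 p (f g) (f y)" using mem_centralizer[OF g'(1)] y by auto
    have "commute3 p (f x) (f y)"
      by (rule commute3_of_commute3_noncentral[OF p f_cube[OF g'(1)] g'(2) f_cube[OF x'(1)] x'(2) f_cube[OF y'(1)] y'(2)])
    then show ?thesis using comm[OF x'(1) y'(1)] by blast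
  qed
qed

lemma of_nat_power_diffs:
  assumes "p > 0"
  shows "of_nat (p ^ 2 - 1) = (of_nat p ^ 2 - 1 :: 'a :: ring_1)"
    and "of_nat (p ^ 3 - p ^ 2) = (of_nat p ^ 3 - of_nat p ^ 2 :: 'a :: ring_1)"
proof -
  have "1 \<le> p ^ 2" "p ^ 2 \<le> p ^ 3" using assms by (simp_all add: power_increasing)
  then show "of_nat (p ^ 2 - 1) = (of_nat p ^ 2 - 1 :: 'a)"
    "of_nat (p ^ 3 - p ^ 2) = (of_nat p ^ 3 - of_nat p ^ 2 :: 'a)"
    by (simp_all only: of_nat_diff of_nat_power of_nat_1)
qed

text \<open>The number is \<open>\<bar>Z(G)\<bar>\<^sup>n (p\<^sup>2\<^sup>n + p\<^sup>n\<^sup>+\<^sup>2 - p\<^sup>2)\<close>; the subtraction is moved to the other side.\<close>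

lemma card_commuting_tuples_phi4:
  assumes p: "Factorial_Ring.prime p" and G: "group G" and fin: "finite (carrier G)"
    and Phi4: "in_Phi4 p G"
  shows "card (commuting_tuples G n) + card (group_center G) ^ n * p ^ 2 =
           card (group_center G) ^ n * (p ^ (2 * n) + p ^ (n + 2))"
proof (induction n)
  case 0
  have "commuting_tuples G 0 = {[]}" by (auto simp: commuting_tuples_def tuples_def)
  then show ?case by (simp add: power2_eq_square)
next
  case (Suc n)
  define k where "k = card (group_center G)"
  have Suc_eq: "card (commuting_tuples G (Suc n)) = k * card (commuting_tuples G n) +
      k * ((p ^ 2 - 1) * (k * p ^ 2) ^ n + (p ^ 3 - p ^ 2) * (k * p) ^ n)"
    unfolding k_def phi4_centralizer_sums(3)[OF assms, symmetric]
    by (rule group.card_commuting_tuples_Suc[OF G fin phi4_centralizer_sums(4)[OF assms]])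
  \<comment> \<open>Over the integers the subtraction is genuine, and the recursion becomes a ring
    identity.\<close>
  have IH: "int (card (commuting_tuples G n)) = int k ^ n * (int p ^ (2 * n) + int p ^ (n + 2) - int p ^ 2)"
    using arg_cong[OF Suc.IH, of int] by (simp add: k_def algebra_simps)
  have "int (card (commuting_tuples G (Suc n))) + int k ^ Suc n * int p ^ 2 =
      int k ^ Suc n * (int p ^ (2 * Suc n) + int p ^ (Suc n + 2))"
    unfolding Suc_eq of_nat_add of_nat_mult of_nat_power IH
      of_nat_power_diffs[OF prime_gt_0_nat[OF p]]
    by (simp add: power_mult_distrib power_mult power_add power2_eq_square power3_eq_cube algebra_simps)
  then have "int (card (commuting_tuples G (Suc n)) + k ^ Suc n * p ^ 2) =
      int (k ^ Suc n * (p ^ (2 * Suc n) + p ^ (Suc n + 2)))"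
    by (simp only: of_nat_add of_nat_mult of_nat_power)
  then show ?case unfolding k_def by (simp only: of_nat_eq_iff)
qed

section \<open>Geometric series and comparison of coefficients\<close>

lemma fps_const_divide_linear:
  "fps_const (a :: 'a :: field) / (1 - fps_const c * fps_X) = Abs_fps (\<lambda>n. a * c ^ n)"
proof -
  have "Abs_fps (\<lambda>n. a * c ^ n) * (1 - fps_const c * fps_X) = fps_const a"
  proof (rule fps_ext)
    fix n
    show "fps_nth (Abs_fps (\<lambda>n. a * c ^ n) * (1 - fps_const c * fps_X)) n = fps_nth (fps_const a) n"
      by (cases n) (simp_all add: right_diff_distrib mult.assoc[symmetric])
  qed
  \<comment> \<open>The constant term is one, so the denominator is nonzero and may be
    cancelled.\<close>
  moreover have "fps_nth (1 - fps_const c * fps_X) 0 \<noteq> 0" by simp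
  then have "1 - fps_const c * fps_X \<noteq> 0" by (metis fps_zero_nth)
  ultimately show ?thesis by (metis nonzero_mult_div_cancel_right)
qed

theorem lemma5p3:
  fixes p m :: nat and G :: "('a, 'b) monoid_scheme"
  assumes "Factorial_Ring.prime p" and "odd p"
    and "group G" and "Coset.order G = p ^ m"
    and "isoclinism_rank p G = 5"
    and "in_Phi4 p G"
  shows
    "fps_compose (A_series G) (fps_const (1 / of_nat (Coset.order G)) * fps_X) =
       fps_const (1 - 1 / of_nat p) / (1 - fps_const (1 / of_nat p ^ 2) * fps_X)
     + fps_const (1 / of_nat p - 1 / of_nat p ^ 3) / (1 - fps_const (1 / of_nat p) * fps_X)
     + fps_const (1 / of_nat p ^ 3) / (1 - fps_X)
   \<and> fps_compose (B_series G) (fps_const (1 / of_nat (Coset.order G)) * fps_X) =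
       fps_const (- (1 / of_nat p)) / (1 - fps_const (1 / of_nat p ^ 3) * fps_X)
     + 1 / (1 - fps_const (1 / of_nat p ^ 2) * fps_X)
     + fps_const (1 / of_nat p) / (1 - fps_const (1 / of_nat p) * fps_X)"
proof -
  note p = assms(1) and G = assms(3)
  define k where "k = card (group_center G)"
  define P :: rat where "P = of_nat p"
  define K :: rat where "K = of_nat k"
  have fin: "finite (carrier G)"
    using assms(4) prime_gt_0_nat[OF p] monoid.order_gt_0_iff_finite[OF group.is_monoid[OF G]] by simp
  note sums = phi4_centralizer_sums[OF p G fin assms(6), folded k_def]
  have order: "Coset.order G = k * p ^ 3" by (rule sums(1))
  have P: "P \<noteq> 0" using prime_gt_0_nat[OF p] by (simp add: P_def)
  have "k * p ^ 3 \<noteq> 0" using prime_gt_0_nat[OF p] by (simp flip: order add: assms(4))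
  then have K: "K \<noteq> 0" by (simp add: K_def)
  have diffs: "rat_of_nat (p ^ 2 - 1) = P ^ 2 - 1" "rat_of_nat (p ^ 3 - p ^ 2) = P ^ 3 - P ^ 2"
    unfolding P_def by (rule of_nat_power_diffs[OF prime_gt_0_nat[OF p]])+
  \<comment> \<open>Substituting \<open>t / |G|\<close> multiplies the \<open>n\<close>-th
    coefficient by this power, as \<open>|G| = K * P ^ 3\<close>.\<close>
  have alpha: "rat_of_nat (alpha_count G n) * (1 / (K * P ^ 3)) ^ n =
      (1 - 1 / P) * (1 / P ^ 2) ^ n + (1 / P - 1 / P ^ 3) * (1 / P) ^ n + 1 / P ^ 3" for n
  proof -
    have "rat_of_nat (alpha_count G n * (k * p ^ 3)) =
        K * ((K * P ^ 3) ^ n + (P ^ 2 - 1) * (K * P ^ 2) ^ n + (P ^ 3 - P ^ 2) * (K * P) ^ n)"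
      unfolding group.alpha_count_order[OF G fin, unfolded order] sums(2)
        of_nat_add of_nat_mult of_nat_power diffs
      by (simp add: K_def P_def)
    then have "rat_of_nat (alpha_count G n) * P ^ 3 =
        (K * P ^ 3) ^ n + (P ^ 2 - 1) * (K * P ^ 2) ^ n + (P ^ 3 - P ^ 2) * (K * P) ^ n"
      using K by (simp add: K_def P_def)
    then have eq: "rat_of_nat (alpha_count G n) =
        ((K * P ^ 3) ^ n + (P ^ 2 - 1) * (K * P ^ 2) ^ n + (P ^ 3 - P ^ 2) * (K * P) ^ n) / P ^ 3"
      using P by (simp add: eq_divide_eq)
    \<comment> \<open>Dividing the centralizer orders by \<open>|G|\<close> leaves the inverses of
      their indices, which are the poles' parameters in the claim.\<close>
    have "(K * P ^ 2) ^ n * (1 / (K * P ^ 3)) ^ n = (1 / P) ^ n"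
      "(K * P) ^ n * (1 / (K * P ^ 3)) ^ n = (1 / P ^ 2) ^ n"
      "(K * P ^ 3) ^ n * (1 / (K * P ^ 3)) ^ n = 1"
      using K P by (simp_all add: power2_eq_square power3_eq_cube flip: power_mult_distrib)
    then have "rat_of_nat (alpha_count G n) * (1 / (K * P ^ 3)) ^ n =
        (1 + (P ^ 2 - 1) * (1 / P) ^ n + (P ^ 3 - P ^ 2) * (1 / P ^ 2) ^ n) / P ^ 3"
      unfolding eq times_divide_eq_left distrib_right mult.assoc by simp
    also have "\<dots> = (1 - 1 / P) * (1 / P ^ 2) ^ n + (1 / P - 1 / P ^ 3) * (1 / P) ^ n + 1 / P ^ 3"
    proof -
      have "(P ^ 2 - 1) / P ^ 3 = 1 / P - 1 / P ^ 3" "(P ^ 3 - P ^ 2) / P ^ 3 = 1 - 1 / P"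
        using P by (simp_all add: field_simps power2_eq_square power3_eq_cube)
      moreover have "(1 + (P ^ 2 - 1) * x + (P ^ 3 - P ^ 2) * y) / P ^ 3 =
          1 / P ^ 3 + (P ^ 2 - 1) / P ^ 3 * x + (P ^ 3 - P ^ 2) / P ^ 3 * y" for x y
        by (simp add: add_divide_distrib)
      ultimately show ?thesis by (simp only: add_ac)
    qed
    finally show ?thesis .
  qed
  have beta: "rat_of_nat (beta_count G n) * (1 / (K * P ^ 3)) ^ n =
      - (1 / P) * (1 / P ^ 3) ^ n + (1 / P ^ 2) ^ n + 1 / P * (1 / P) ^ n" for n
  proof -
    \<comment> \<open>The count of commuting tuples enters at length \<open>Suc n\<close>; the
      surplus factor \<open>K * P ^ 2\<close> is cancelled next.\<close>
    have "rat_of_nat (beta_count G n * (k * p ^ 3)) =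
        K ^ Suc n * (P ^ (2 * Suc n) + P ^ (Suc n + 2) - P ^ 2)"
      unfolding group.beta_count_order[OF G fin, unfolded order]
      using arg_cong[OF card_commuting_tuples_phi4[OF p G fin assms(6), of "Suc n"], of rat_of_nat]
      by (simp add: K_def P_def k_def algebra_simps)
    then have "(K * P ^ 2) * (rat_of_nat (beta_count G n) * P) =
        (K * P ^ 2) * ((K * P ^ 2) ^ n + P * (K * P) ^ n - K ^ n)"
      by (simp add: K_def P_def power_mult_distrib power_mult power_add power2_eq_square power3_eq_cube algebra_simps)
    then have "rat_of_nat (beta_count G n) * P = (K * P ^ 2) ^ n + P * (K * P) ^ n - K ^ n"
      using K P by (subst (asm) mult_left_cancel) simp_all
    then have eq: "rat_of_nat (beta_count G n) =
        ((K * P ^ 2) ^ n + P * (K * P) ^ n - K ^ n) / P"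
      using P by (simp add: eq_divide_eq)
    have "(K * P ^ 2) ^ n * (1 / (K * P ^ 3)) ^ n = (1 / P) ^ n"
      "(K * P) ^ n * (1 / (K * P ^ 3)) ^ n = (1 / P ^ 2) ^ n"
      "K ^ n * (1 / (K * P ^ 3)) ^ n = (1 / P ^ 3) ^ n"
      using K P by (simp_all add: power2_eq_square power3_eq_cube flip: power_mult_distrib)
    then have "rat_of_nat (beta_count G n) * (1 / (K * P ^ 3)) ^ n =
        ((1 / P) ^ n + P * (1 / P ^ 2) ^ n - (1 / P ^ 3) ^ n) / P"
      unfolding eq times_divide_eq_left distrib_right left_diff_distrib mult.assoc by simp
    also have "\<dots> = - (1 / P) * (1 / P ^ 3) ^ n + (1 / P ^ 2) ^ n + 1 / P * (1 / P) ^ n"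
      using P by (simp add: add_divide_distrib diff_divide_distrib)
    finally show ?thesis .
  qed
  have order_rat: "1 / rat_of_nat (Coset.order G) = 1 / (K * P ^ 3)"
    by (simp add: order K_def P_def)
  \<comment> \<open>The claim also contains the degenerate shapes with ratio one and with numerator
    one.\<close>
  have geo: "fps_const a / (1 - fps_X) = Abs_fps (\<lambda>n. a)"
    "1 / (1 - fps_const c * fps_X) = Abs_fps (\<lambda>n. c ^ n)" for a c :: rat
    using fps_const_divide_linear[of a 1] fps_const_divide_linear[of 1 c] by simp_all
  show ?thesis
    unfolding A_series_def B_series_def order_rat fps_compose_linear fps_const_divide_linear geo
    using alpha beta by (simp add: fps_eq_iff mult.commute flip: P_def)
qed

end
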